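(* Let $\mathbb{F}$ be a field of characteristic zero and let $\mathcal{L}$ be the Lie algebra over $\mathbb{F}$ with basis $\{L_{i,j}\mid i,j\in\mathbb{Z}\}$ and bracket $[L_{i,j},L_{k,l}]=((j+1)k-(l+1)i)L_{i+k,j+l}$. Let $A_{a,b}$ ($a,b\in\mathbb{F}$), $A$, $B$, $C$ be the $\mathcal{L}$-modules with basis $\{v_{k,l}\mid k,l\in\mathbb{Z}\}$ defined in the context. Then: (i) $A_{a,b}$ is irreducible if and only if $a\notin\mathbb{Z}$, or $a\in\mathbb{Z}$ and $b\notin\mathbb{Z}$. (ii) If $a,b\in\mathbb{Z}$, then $A_{a,b}$ has 3 composition factors with the structure $$V_2\to V_3\to V_1,$$ where $V_1=\mathbb{F}v_{-a,b-1}$, $V_2=\mathbb{F}v_{-a,b-2}$, $V_3=\mathrm{span}\{v_{k,l}\mid (k,l)\neq(-a,b-1),(-a,b-2)\}$. (iii) Each of $A,B,C$ has three composition factors, with the structures $$A:\; V_3\to V_1 \text{ and } V_3\to V_2;\qquad B:\; V_1\to V_3 \text{ and } V_2\to V_3;\qquad C:\; V_1\to V_3\to V_2,$$ where $V_1=\mathbb{F}v_{0,-1}$, $V_2=\mathbb{F}v_{0,-2}$, $V_3=\mathrm{span}\{v_{k,l}\mid (k,l)\neq(0,-1),(0,-2)\}$.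
   Context: Notation: for a module $V$ and two subsets $V_1,V_2$ of $V$, write $V_1\to V_2$ (or $V_2\leftarrow V_1$) if $V_2$ can be generated by $V_1$, i.e. $V_2\subset U(\mathcal{L})V_1$, where $U(\mathcal{L})$ is the universal enveloping algebra of $\mathcal{L}$. The diagrams describe the structure of the composition factors, which are the subquotients corresponding to the subspaces $V_1,V_2,V_3$. The modules are defined as follows, for $i,j,k,l\in\mathbb{Z}$ ($\delta$ is the Kronecker delta, and $\mathbb{Z}$ is regarded as a subset of $\mathbb{F}$): $A_{a,b}$: $\;L_{i,j}v_{k,l}=((j+1)(a+k)+(b-1-l)i)\,v_{i+k,j+l}$. $A$: $\;L_{i,j}v_{k,l}=((j+1)k-(l+1)i)\,v_{i+k,j+l}+\delta_{i+k,0}\,\delta_{l+j,-2}\,i\,v_{0,-2}$ for $(k,l)\neq(0,-2)$, and $L_{i,j}v_{0,-2}=0$. $B$: $\;L_{i,j}v_{k,l}=((j+1)k-(l+1)i)\,v_{i+k,j+l}$ for $(k,l)\neq(0,-1),(0,-2)$ and $(i+k,j+l)\neq(0,-1)$; $\;L_{i,j}v_{-i,-j-1}=0$; $\;L_{i,j}v_{0,-1}=i\,v_{i,j-1}$; $\;L_{i,j}v_{0,-2}=i\,v_{i,j-2}$. $C$: $\;L_{i,j}v_{k,l}=((j+1)k-(l+1)i)\,v_{i+k,j+l}+\delta_{i+k,0}\,\delta_{l+j,-2}\,i\,v_{0,-2}$ for $(k,l)\neq(0,-1),(0,-2)$ and $(i+k,j+l)\neq(0,-1)$; $\;L_{i,j}v_{-i,-j-1}=0$;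 $\;L_{i,j}v_{0,-1}=i\,v_{i,j-1}$; $\;L_{i,j}v_{0,-2}=0$. *)

theory Defs
  imports Complex_Main "HOL-Library.Poly_Mapping"
begin

section \<open>Lie algebras and their modules\<close>

locale lie_algebra = L: vector_space scaleL
  for scaleL :: "'f::field \<Rightarrow> 'l::ab_group_add \<Rightarrow> 'l" +
  fixes bracket :: "'l \<Rightarrow> 'l \<Rightarrow> 'l"
  assumes bracket_add_left: "bracket (x + y) z = bracket x z + bracket y z"
    and bracket_scale_left: "bracket (scaleL c x) z = scaleL c (bracket x z)"
    and bracket_add_right: "bracket x (y + z) = bracket x y + bracket x z"
    and bracket_scale_right: "bracket x (scaleL c z) = scaleL c (bracket x z)"
    and bracket_self: "bracket x x = 0"
    and jacobi: "bracket x (bracket y z) + bracket y (bracket z x) + bracket z (bracket x y) = 0"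

locale lie_module = lie_algebra scaleL bracket + V: vector_space scaleV
  for scaleL :: "'f::field \<Rightarrow> 'l::ab_group_add \<Rightarrow> 'l"
    and bracket :: "'l \<Rightarrow> 'l \<Rightarrow> 'l"
    and scaleV :: "'f \<Rightarrow> 'v::ab_group_add \<Rightarrow> 'v" +
  fixes act :: "'l \<Rightarrow> 'v \<Rightarrow> 'v"
  assumes act_add_left: "act (x + y) v = act x v + act y v"
    and act_scale_left: "act (scaleL c x) v = scaleV c (act x v)"
    and act_add_right: "act x (u + v) = act x u + act x v"
    and act_scale_right: "act x (scaleV c v) = scaleV c (act x v)"
    and act_bracket: "act (bracket x y) v = act x (act y v) - act y (act x v)"
begin

definition submodule :: "'v set \<Rightarrow> bool" where
  "submodule M \<longleftrightarrow> V.subspace M \<and> (\<forall>x. \<forall>v\<in>M. act x v \<in> M)"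

definition irreducible_module :: bool where
  "irreducible_module \<longleftrightarrow>
     (UNIV :: 'v set) \<noteq> {0} \<and> (\<forall>M. submodule M \<longrightarrow> M = {0} \<or> M = UNIV)"

text \<open>
  The universal enveloping algebra is spanned by the products \<open>x\<^sub>1 \<cdots> x\<^sub>n\<close>, \<open>n \<ge> 0\<close>, of elements
  of the Lie algebra; such a product acts by \<open>v \<mapsto> x\<^sub>1 (\<dots> (x\<^sub>n v))\<close>.
\<close>

definition env_span :: "'v set \<Rightarrow> 'v set" where
  "env_span S = V.span {foldr act xs v | xs v. v \<in> S}"

definition generates :: "'v set \<Rightarrow> 'v set \<Rightarrow> bool" where
  "generates S T \<longleftrightarrow> T \<subseteq> env_span S"

definition coset :: "'v set \<Rightarrow> 'v \<Rightarrow> 'v set" where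
  "coset N v = (\<lambda>n. v + n) ` N"

definition quotient :: "'v set \<Rightarrow> 'v set \<Rightarrow> 'v set set" where
  "quotient M N = coset N ` M"

text \<open>
  For submodules \<open>N \<subseteq> M\<close> the operations of \<open>M / N\<close> are induced from those on
  representatives; \<open>N\<close> itself is the zero of the quotient.
\<close>

definition submodule_of_quotient :: "'v set \<Rightarrow> 'v set \<Rightarrow> 'v set set \<Rightarrow> bool" where
  "submodule_of_quotient M N Q \<longleftrightarrow>
     Q \<subseteq> quotient M N \<and> N \<in> Q \<and>
     (\<forall>u\<in>M. \<forall>v\<in>M. coset N u \<in> Q \<longrightarrow> coset N v \<in> Q \<longrightarrow> coset N (u + v) \<in> Q) \<and>
     (\<forall>c. \<forall>v\<in>M. coset N v \<in> Q \<longrightarrow> coset N (scaleV c v) \<in> Q) \<and>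
     (\<forall>x. \<forall>v\<in>M. coset N v \<in> Q \<longrightarrow> coset N (act x v) \<in> Q)"

definition irreducible_quotient :: "'v set \<Rightarrow> 'v set \<Rightarrow> bool" where
  "irreducible_quotient M N \<longleftrightarrow>
     quotient M N \<noteq> {N} \<and>
     (\<forall>Q. submodule_of_quotient M N Q \<longrightarrow> Q = {N} \<or> Q = quotient M N)"

definition composition_series :: "'v set list \<Rightarrow> bool" where
  "composition_series Ms \<longleftrightarrow>
     Ms \<noteq> [] \<and> hd Ms = {0} \<and> last Ms = UNIV \<and> (\<forall>M\<in>set Ms. submodule M) \<and>
     (\<forall>t. Suc t < length Ms \<longrightarrow>
        Ms ! t \<subseteq> Ms ! Suc t \<and> irreducible_quotient (Ms ! Suc t) (Ms ! t))"

text \<open>The subspace \<open>W\<close> of \<open>M\<close> is mapped isomorphically onto \<open>M / N\<close> by the projection.\<close>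

definition corresponds :: "'v set \<Rightarrow> 'v set \<Rightarrow> 'v set \<Rightarrow> bool" where
  "corresponds W M N \<longleftrightarrow>
     V.subspace W \<and> W \<subseteq> M \<and> bij_betw (coset N) W (quotient M N)"

text \<open>
  \<open>composition_structure Ws D\<close>: the module has exactly \<open>card Ws\<close> composition factors, namely
  the subquotients corresponding to the subspaces in \<open>Ws\<close>, and \<open>D\<close> is the set of arrows of the
  diagram with vertices \<open>Ws\<close>.  An arrow from \<open>W\<close> to \<open>W'\<close> means that \<open>W\<close> generates \<open>W'\<close>; only arrows
  that do not follow by transitivity are drawn, and unconnected subspaces do not generate each other.
\<close>

definition composition_structure :: "'v set set \<Rightarrow> ('v set \<times> 'v set) set \<Rightarrow> bool" where
  "composition_structure Ws D \<longleftrightarrow>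
     (\<exists>Ms ws. composition_series Ms \<and> distinct ws \<and> set ws = Ws \<and>
        length Ms = Suc (length ws) \<and>
        (\<forall>t<length ws. corresponds (ws ! t) (Ms ! Suc t) (Ms ! t))) \<and>
     (\<forall>W\<in>Ws. \<forall>W'\<in>Ws. W \<noteq> W' \<longrightarrow> (generates W W' \<longleftrightarrow> (W, W') \<in> D\<^sup>+))"

end


section \<open>Spaces with a basis indexed by pairs of integers\<close>

text \<open>
  Finitely supported functions serve both as the underlying space of the Lie algebra (with
  \<open>e k l\<close> in the role of \<open>L\<^bsub>k,l\<^esub>\<close>) and of its modules (with \<open>e k l\<close> in the role of \<open>v\<^bsub>k,l\<^esub>\<close>).
\<close>

type_synonym 'f bispace = "(int \<times> int) \<Rightarrow>\<^sub>0 'f"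

definition scale :: "'f::field \<Rightarrow> 'f bispace \<Rightarrow> 'f bispace" where
  "scale c p = Poly_Mapping.map ((*) c) p"

definition e :: "int \<Rightarrow> int \<Rightarrow> 'f::field bispace" where
  "e k l = Poly_Mapping.single (k, l) 1"

definition lin_ext :: "(int \<times> int \<Rightarrow> 'f::field bispace) \<Rightarrow> 'f bispace \<Rightarrow> 'f bispace" where
  "lin_ext f v = (\<Sum>q\<in>Poly_Mapping.keys v. scale (Poly_Mapping.lookup v q) (f q))"

definition bilin_ext ::
    "(int \<Rightarrow> int \<Rightarrow> int \<Rightarrow> int \<Rightarrow> 'f::field bispace) \<Rightarrow> 'f bispace \<Rightarrow> 'f bispace \<Rightarrow> 'f bispace" where
  "bilin_ext \<beta> x v = lin_ext (\<lambda>(i, j). lin_ext (\<lambda>(k, l). \<beta> i j k l) v) x"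

lemma lookup_scale [simp]: "Poly_Mapping.lookup (scale c p) q = c * Poly_Mapping.lookup p q"
  by (simp add: scale_def map.rep_eq when_def)

interpretation bispace: vector_space "scale :: 'f::field \<Rightarrow> 'f bispace \<Rightarrow> 'f bispace"
  by unfold_locales (auto intro!: poly_mapping_eqI simp: lookup_add algebra_simps)

lemma lin_ext_superset:
  assumes "finite S" "Poly_Mapping.keys v \<subseteq> S"
  shows "lin_ext f v = (\<Sum>q\<in>S. scale (Poly_Mapping.lookup v q) (f q))"
  unfolding lin_ext_def using assms
  by (intro sum.mono_neutral_left) (auto simp: in_keys_iff)

lemma lin_ext_add: "lin_ext f (u + v) = lin_ext f u + lin_ext f v"
proof -
  let ?S = "Poly_Mapping.keys u \<union> Poly_Mapping.keys v"
  have "Poly_Mapping.keys (u + v) \<subseteq> ?S"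
    by (rule keys_add)
  then show ?thesis
    by (simp add: lin_ext_superset[of ?S] lookup_add bispace.scale_left_distrib sum.distrib)
qed

lemma lin_ext_scale: "lin_ext f (scale c v) = scale c (lin_ext f v)"
proof -
  have "Poly_Mapping.keys (scale c v) \<subseteq> Poly_Mapping.keys v"
    by (auto simp: in_keys_iff)
  then show ?thesis
    by (simp add: lin_ext_superset[of "Poly_Mapping.keys v"] bispace.scale_sum_right)
qed

lemma lin_ext_zero [simp]: "lin_ext f 0 = 0"
  by (simp add: lin_ext_def)

lemma lin_ext_single [simp]: "lin_ext f (Poly_Mapping.single q c) = scale c (f q)"
  by (simp add: lin_ext_superset[of "{q}"])

lemma lin_ext_fun_add: "lin_ext (\<lambda>q. f q + g q) v = lin_ext f v + lin_ext g v"
  by (simp add: lin_ext_def bispace.scale_right_distrib sum.distrib)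

lemma lin_ext_fun_scale: "lin_ext (\<lambda>q. scale c (f q)) v = scale c (lin_ext f v)"
  by (simp add: lin_ext_def bispace.scale_sum_right mult.commute)

lemma bilin_ext_add_left: "bilin_ext \<beta> (x + y) v = bilin_ext \<beta> x v + bilin_ext \<beta> y v"
  by (simp add: bilin_ext_def lin_ext_add)

lemma bilin_ext_scale_left: "bilin_ext \<beta> (scale c x) v = scale c (bilin_ext \<beta> x v)"
  by (simp add: bilin_ext_def lin_ext_scale)

lemma bilin_ext_add_right: "bilin_ext \<beta> x (u + v) = bilin_ext \<beta> x u + bilin_ext \<beta> x v"
  by (simp add: bilin_ext_def lin_ext_add case_prod_unfold flip: lin_ext_fun_add)

lemma bilin_ext_scale_right: "bilin_ext \<beta> x (scale c v) = scale c (bilin_ext \<beta> x v)"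
  by (simp add: bilin_ext_def lin_ext_scale case_prod_unfold flip: lin_ext_fun_scale)

lemmas bilin_ext_linear =
  bilin_ext_add_left bilin_ext_scale_left bilin_ext_add_right bilin_ext_scale_right

lemma bilin_ext_single [simp]:
  "bilin_ext \<beta> (Poly_Mapping.single (i, j) c) (Poly_Mapping.single (k, l) d) =
     scale (c * d) (\<beta> i j k l)"
  by (simp add: bilin_ext_def)

lemma bilin_ext_e: "bilin_ext \<beta> (e i j) (e k l) = \<beta> i j k l"
  by (simp add: e_def)

lemma bilin_ext_zero_left [simp]: "bilin_ext \<beta> 0 v = 0"
  by (simp add: bilin_ext_def)

lemma bilin_ext_zero_right [simp]: "bilin_ext \<beta> x 0 = 0"
  using bilin_ext_scale_right[of \<beta> x 0 0] by simp

lemma bispace_induct [case_names add scale basis]: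
  fixes P :: "'f::field bispace \<Rightarrow> bool"
  assumes add: "\<And>u v. P u \<Longrightarrow> P v \<Longrightarrow> P (u + v)"
    and scale: "\<And>c v. P v \<Longrightarrow> P (scale c v)"
    and basis: "\<And>k l. P (e k l)"
  shows "P v"
proof -
  have expand: "v = (\<Sum>q\<in>Poly_Mapping.keys v. scale (Poly_Mapping.lookup v q) (e (fst q) (snd q)))"
  proof (rule poly_mapping_eqI)
    fix r
    have "(\<Sum>q\<in>Poly_Mapping.keys v.
            Poly_Mapping.lookup (scale (Poly_Mapping.lookup v q) (e (fst q) (snd q))) r) =
          (\<Sum>q\<in>Poly_Mapping.keys v. if q = r then Poly_Mapping.lookup v q else 0)"
      by (intro sum.cong) (auto simp: e_def lookup_single when_def)
    also have "\<dots> = Poly_Mapping.lookup v r"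
      by (simp add: in_keys_iff)
    finally show "Poly_Mapping.lookup v r = Poly_Mapping.lookup
        (\<Sum>q\<in>Poly_Mapping.keys v. scale (Poly_Mapping.lookup v q) (e (fst q) (snd q))) r"
      by (simp add: lookup_sum)
  qed
  have zero: "P 0"
    using scale[OF basis, of 0 0 0] by simp
  have "P (\<Sum>q\<in>S. scale (Poly_Mapping.lookup v q) (e (fst q) (snd q)))" if "finite S" for S
    using that by (induction S rule: finite_induct) (auto intro: zero add scale basis)
  then show ?thesis
    by (subst expand) simp
qed


section \<open>The Lie algebra and the four modules\<close>

definition L_basis :: "int \<Rightarrow> int \<Rightarrow> int \<Rightarrow> int \<Rightarrow> 'f::field_char_0 bispace" where
  "L_basis i j k l = scale (of_int ((j + 1) * k - (l + 1) * i)) (e (i + k) (j + l))"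

definition L_bracket :: "'f::field_char_0 bispace \<Rightarrow> 'f bispace \<Rightarrow> 'f bispace" where
  "L_bracket = bilin_ext L_basis"

definition Aab_basis :: "'f \<Rightarrow> 'f \<Rightarrow> int \<Rightarrow> int \<Rightarrow> int \<Rightarrow> int \<Rightarrow> 'f::field_char_0 bispace" where
  "Aab_basis a b i j k l =
     scale ((of_int j + 1) * (a + of_int k) + (b - 1 - of_int l) * of_int i) (e (i + k) (j + l))"

definition A_basis :: "int \<Rightarrow> int \<Rightarrow> int \<Rightarrow> int \<Rightarrow> 'f::field_char_0 bispace" where
  "A_basis i j k l =
     (if (k, l) = (0, -2) then 0
      else scale (of_int ((j + 1) * k - (l + 1) * i)) (e (i + k) (j + l)) +
           (if i + k = 0 \<and> l + j = -2 then scale (of_int i) (e 0 (-2)) else 0))"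

text \<open>
  In the modules \<open>B\<close> and \<open>C\<close> the defining cases overlap, e.g. for \<open>L\<^bsub>0,0\<^esub> v\<^bsub>0,-1\<^esub>\<close> and
  \<open>L\<^bsub>0,1\<^esub> v\<^bsub>0,-2\<^esub>\<close>; the overlapping formulas all give \<open>0\<close>, so the order of the cases is
  immaterial.
\<close>

definition B_basis :: "int \<Rightarrow> int \<Rightarrow> int \<Rightarrow> int \<Rightarrow> 'f::field_char_0 bispace" where
  "B_basis i j k l =
     (if (k, l) = (0, -1) then scale (of_int i) (e i (j - 1))
      else if (k, l) = (0, -2) then scale (of_int i) (e i (j - 2))
      else if (k, l) = (- i, - j - 1) then 0
      else scale (of_int ((j + 1) * k - (l + 1) * i)) (e (i + k) (j + l)))"

definition C_basis :: "int \<Rightarrow> int \<Rightarrow> int \<Rightarrow> int \<Rightarrow> 'f::field_char_0 bispace" where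
  "C_basis i j k l =
     (if (k, l) = (0, -1) then scale (of_int i) (e i (j - 1))
      else if (k, l) = (0, -2) then 0
      else if (k, l) = (- i, - j - 1) then 0
      else scale (of_int ((j + 1) * k - (l + 1) * i)) (e (i + k) (j + l)) +
           (if i + k = 0 \<and> l + j = -2 then scale (of_int i) (e 0 (-2)) else 0))"

definition Aab_act :: "'f \<Rightarrow> 'f \<Rightarrow> 'f::field_char_0 bispace \<Rightarrow> 'f bispace \<Rightarrow> 'f bispace" where
  "Aab_act a b = bilin_ext (Aab_basis a b)"

definition A_act :: "'f::field_char_0 bispace \<Rightarrow> 'f bispace \<Rightarrow> 'f bispace" where
  "A_act = bilin_ext A_basis"

definition B_act :: "'f::field_char_0 bispace \<Rightarrow> 'f bispace \<Rightarrow> 'f bispace" where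
  "B_act = bilin_ext B_basis"

definition C_act :: "'f::field_char_0 bispace \<Rightarrow> 'f bispace \<Rightarrow> 'f bispace" where
  "C_act = bilin_ext C_basis"

lemma action_from_basis:
  fixes \<beta> :: "int \<Rightarrow> int \<Rightarrow> int \<Rightarrow> int \<Rightarrow> 'f::field_char_0 bispace"
  assumes "\<And>i j k l m n.
      bilin_ext \<beta> (L_basis i j k l) (e m n) =
      bilin_ext \<beta> (e i j) (\<beta> k l m n) - bilin_ext \<beta> (e k l) (\<beta> i j m n)"
  shows "bilin_ext \<beta> (L_bracket x y) v =
         bilin_ext \<beta> x (bilin_ext \<beta> y v) - bilin_ext \<beta> y (bilin_ext \<beta> x v)"
proof (induction x arbitrary: y v rule: bispace_induct)
  case (basis i j)
  show ?case
  proof (induction y arbitrary: v rule: bispace_induct)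
    case (basis k l)
    show ?case
    proof (induction v rule: bispace_induct)
      case (basis m n)
      show ?case
        using assms by (simp add: L_bracket_def bilin_ext_e)
    qed (simp_all add: L_bracket_def bilin_ext_linear bispace.scale_right_diff_distrib)
  qed (simp_all add: L_bracket_def bilin_ext_linear bispace.scale_right_diff_distrib)
qed (simp_all add: L_bracket_def bilin_ext_linear bispace.scale_right_diff_distrib)

lemma Aab_basis_action:
  "bilin_ext (Aab_basis a b) (L_basis i j k l) (e m n) =
   bilin_ext (Aab_basis a b) (e i j) (Aab_basis a b k l m n) -
   bilin_ext (Aab_basis a b) (e k l) (Aab_basis a b i j m n)"
  by (auto simp: L_basis_def Aab_basis_def bilin_ext_linear bilin_ext_e add_ac
      simp flip: bispace.scale_left_diff_distrib, simp add: algebra_simps)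

lemma L_bracket_eq_Aab: "L_bracket = (Aab_act 0 0 :: 'f::field_char_0 bispace \<Rightarrow> _)"
proof -
  have "L_basis = (Aab_basis 0 0 :: int \<Rightarrow> int \<Rightarrow> int \<Rightarrow> int \<Rightarrow> 'f::field_char_0 bispace)"
    by (intro ext) (simp add: L_basis_def Aab_basis_def algebra_simps)
  then show ?thesis
    by (simp add: L_bracket_def Aab_act_def)
qed

lemma L_bracket_swap: "L_bracket x y = - L_bracket y x"
proof (induction x arbitrary: y rule: bispace_induct)
  case (basis i j)
  show ?case
  proof (induction y rule: bispace_induct)
    case (basis k l)
    show ?case
      by (simp add: L_bracket_def bilin_ext_e L_basis_def add.commute
          flip: bispace.scale_minus_left)
  qed (simp_all add: L_bracket_def bilin_ext_linear)
qed (simp_all add: L_bracket_def bilin_ext_linear)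

lemma lie_algebra_L: "lie_algebra scale (L_bracket :: 'f::field_char_0 bispace \<Rightarrow> _)"
proof unfold_locales
  fix x y z :: "'f bispace"
  have "scale 2 (L_bracket x x) = L_bracket x x + L_bracket x x"
    using bispace.scale_left_distrib[of 1 1 "L_bracket x x"] by simp
  also have "\<dots> = 0"
    using L_bracket_swap[of x x] by (simp only: eq_neg_iff_add_eq_0)
  finally have "scale 2 (L_bracket x x) = 0" .
  then show "L_bracket x x = 0"
    by simp
  show "L_bracket x (L_bracket y z) + L_bracket y (L_bracket z x) + L_bracket z (L_bracket x y) = 0"
  proof -
    have "L_bracket y (L_bracket z x) = - L_bracket y (L_bracket x z)"
      using L_bracket_swap[of z x] bilin_ext_scale_right[of L_basis y "-1" "L_bracket x z"]
      by (simp add: L_bracket_def)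
    moreover have "L_bracket z (L_bracket x y) = - L_bracket (L_bracket x y) z"
      by (rule L_bracket_swap)
    moreover have "L_bracket (L_bracket x y) z =
        L_bracket x (L_bracket y z) - L_bracket y (L_bracket x z)"
      using action_from_basis[OF Aab_basis_action, of 0 0 x y z]
      by (simp add: L_bracket_eq_Aab flip: Aab_act_def)
    ultimately show ?thesis
      by simp
  qed
qed (simp_all add: L_bracket_def bilin_ext_linear)

lemma lie_module_from_basis:
  fixes \<beta> :: "int \<Rightarrow> int \<Rightarrow> int \<Rightarrow> int \<Rightarrow> 'f::field_char_0 bispace"
  assumes "\<And>i j k l m n.
      bilin_ext \<beta> (L_basis i j k l) (e m n) =
      bilin_ext \<beta> (e i j) (\<beta> k l m n) - bilin_ext \<beta> (e k l) (\<beta> i j m n)"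
  shows "lie_module scale L_bracket scale (bilin_ext \<beta>)"
  using lie_algebra_L action_from_basis[OF assms]
  by (intro lie_module.intro lie_module_axioms.intro bispace.vector_space_axioms)
     (simp_all add: bilin_ext_linear)

lemma lie_module_Aab: "lie_module scale L_bracket scale (Aab_act a b)"
  unfolding Aab_act_def by (rule lie_module_from_basis) (rule Aab_basis_action)

lemma lie_module_from_coefficients:
  fixes \<alpha> \<gamma> :: "int \<Rightarrow> int \<Rightarrow> int \<Rightarrow> int \<Rightarrow> int"
    and \<beta> :: "int \<Rightarrow> int \<Rightarrow> int \<Rightarrow> int \<Rightarrow> 'f::field_char_0 bispace"
  assumes \<beta>: "\<And>i j k l. \<beta> i j k l =
      scale (of_int (\<alpha> i j k l)) (e (i + k) (j + l)) + scale (of_int (\<gamma> i j k l)) (e 0 (-2))"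
    and \<alpha>: "\<And>i j k l m n.
      ((j + 1) * k - (l + 1) * i) * \<alpha> (i + k) (j + l) m n =
      \<alpha> k l m n * \<alpha> i j (k + m) (l + n) - \<alpha> i j m n * \<alpha> k l (i + m) (j + n)"
    and \<gamma>: "\<And>i j k l m n.
      ((j + 1) * k - (l + 1) * i) * \<gamma> (i + k) (j + l) m n =
      \<alpha> k l m n * \<gamma> i j (k + m) (l + n) - \<alpha> i j m n * \<gamma> k l (i + m) (j + n)"
    and zero: "\<And>i j k l m n. \<gamma> k l m n = 0 \<or> \<beta> i j 0 (-2) = 0"
  shows "lie_module scale L_bracket scale (bilin_ext \<beta>)"
proof (rule lie_module_from_basis)
  fix i j k l m n
  have act_\<beta>: "bilin_ext \<beta> (e i j) (\<beta> k l m n) =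
      scale (of_int (\<alpha> k l m n * \<alpha> i j (k + m) (l + n))) (e (i + k + m) (j + l + n)) +
      scale (of_int (\<alpha> k l m n * \<gamma> i j (k + m) (l + n))) (e 0 (-2))" for i j k l m n
  proof -
    have z: "scale (of_int (\<gamma> k l m n)) (\<beta> i j 0 (-2)) = 0"
      using zero[of k l m n i j] by auto
    have "bilin_ext \<beta> (e i j) (\<beta> k l m n) =
        scale (of_int (\<alpha> k l m n)) (\<beta> i j (k + m) (l + n)) +
        scale (of_int (\<gamma> k l m n)) (\<beta> i j 0 (-2))"
      unfolding \<beta>[of k l m n] by (simp add: bilin_ext_linear bilin_ext_e)
    then show ?thesis
      unfolding z by (simp add: \<beta> bispace.scale_right_distrib add.assoc)
  qed
  have "bilin_ext \<beta> (L_basis i j k l) (e m n) =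
      scale (of_int (((j + 1) * k - (l + 1) * i) * \<alpha> (i + k) (j + l) m n)) (e (i + k + m) (j + l + n)) +
      scale (of_int (((j + 1) * k - (l + 1) * i) * \<gamma> (i + k) (j + l) m n)) (e 0 (-2))"
    by (simp add: L_basis_def bilin_ext_linear bilin_ext_e \<beta> bispace.scale_right_distrib)
  also have "\<dots> = bilin_ext \<beta> (e i j) (\<beta> k l m n) - bilin_ext \<beta> (e k l) (\<beta> i j m n)"
    unfolding \<alpha> \<gamma> act_\<beta>
    by (simp add: bispace.scale_left_diff_distrib add.commute[of k i] add.commute[of l j])
  finally show "bilin_ext \<beta> (L_basis i j k l) (e m n) =
      bilin_ext \<beta> (e i j) (\<beta> k l m n) - bilin_ext \<beta> (e k l) (\<beta> i j m n)" .
qed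

lemma A_coeff_module:
  fixes i j k l m n :: int
  shows "((j + 1) * k - (l + 1) * i) *
      (if m = 0 \<and> n = - 2 then 0 else (j + l + 1) * m - (n + 1) * (i + k)) =
    (if m = 0 \<and> n = - 2 then 0 else (l + 1) * m - (n + 1) * k) *
      (if k + m = 0 \<and> l + n = - 2 then 0 else (j + 1) * (k + m) - (l + n + 1) * i) -
    (if m = 0 \<and> n = - 2 then 0 else (j + 1) * m - (n + 1) * i) *
      (if i + m = 0 \<and> j + n = - 2 then 0 else (l + 1) * (i + m) - (j + n + 1) * k)"
  by (cases "m = 0 \<and> n = - 2"; cases "k + m = 0 \<and> l + n = - 2"; cases "i + m = 0 \<and> j + n = - 2";
      simp only: if_True if_False simp_thms; (elim conjE)?; algebra)

lemma A_coeff_cocycle: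
  fixes i j k l m n :: int
  shows "((j + 1) * k - (l + 1) * i) * (if i + k + m = 0 \<and> j + l + n = - 2 then i + k else 0) =
    (if m = 0 \<and> n = - 2 then 0 else (l + 1) * m - (n + 1) * k) *
      (if i + (k + m) = 0 \<and> j + (l + n) = - 2 then i else 0) -
    (if m = 0 \<and> n = - 2 then 0 else (j + 1) * m - (n + 1) * i) *
      (if k + (i + m) = 0 \<and> l + (j + n) = - 2 then k else 0)"
proof (cases "i + k + m = 0 \<and> j + l + n = - 2")
  case True
  then have mn: "m = - i - k" "n = - 2 - j - l"
    by linarith+
  have "k + (i + m) = 0 \<and> l + (j + n) = - 2" "i + (k + m) = 0 \<and> j + (l + n) = - 2"
    using True by linarith+
  note * = if_P[OF True] if_P[OF this(1)] if_P[OF this(2)]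
  show ?thesis
  proof (cases "m = 0 \<and> n = - 2")
    case True
    then have "i + k = 0"
      using mn by linarith
    then show ?thesis
      unfolding * if_P[OF True] by simp
  next
    case False
    have "((j + 1) * k - (l + 1) * i) * (i + k) =
        ((l + 1) * m - (n + 1) * k) * i - ((j + 1) * m - (n + 1) * i) * k"
      by (simp add: mn algebra_simps)
    then show ?thesis
      unfolding * if_not_P[OF False] .
  qed
next
  case False
  then have "\<not> (k + (i + m) = 0 \<and> l + (j + n) = - 2)" "\<not> (i + (k + m) = 0 \<and> j + (l + n) = - 2)"
    by linarith+
  then show ?thesis
    unfolding if_not_P[OF False] by (simp only: if_False mult_zero_right diff_self)
qed

lemma lie_module_A: "lie_module scale L_bracket scale A_act"
  unfolding A_act_def
proof (rule lie_module_from_coefficients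
      [where \<alpha> = "\<lambda>i j k l. if k = 0 \<and> l = - 2 then 0 else (j + 1) * k - (l + 1) * i"
         and \<gamma> = "\<lambda>i j k l. if i + k = 0 \<and> j + l = - 2 then i else 0"], goal_cases)
  case (1 i j k l)
  show ?case
    by (auto simp: A_basis_def add.commute)
next
  case 2
  show ?case
    by (rule A_coeff_module)
next
  case 3
  show ?case
    by (rule A_coeff_cocycle)
next
  case 4
  show ?case
    by (simp add: A_basis_def)
qed

definition B_coeff :: "int \<Rightarrow> int \<Rightarrow> int \<Rightarrow> int \<Rightarrow> int" where
  "B_coeff i j k l =
     (if k = 0 \<and> l = - 1 then i
      else if i + k = 0 \<and> j + l = - 1 then 0 else (j + 1) * k - (l + 1) * i)"

lemma B_coeff_zero:
  assumes "k + m = 0" "l + n = - 2"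
  shows "B_coeff k l m n = 0"
proof -
  have [simp]: "m = - k" "n = - 2 - l"
    using assms by linarith+
  show ?thesis
    by (simp add: B_coeff_def algebra_simps)
qed

lemma B_coeff_top:
  "((j + 1) * k - (l + 1) * i) * (i + k) = k * B_coeff i j k (l - 1) - i * B_coeff k l i (j - 1)"
proof (cases "i + k = 0 \<and> j + l = 0")
  case True
  then have [simp]: "k = - i" "l = - j"
    by linarith+
  show ?thesis
    by (simp add: B_coeff_def)
next
  case False
  have "k * B_coeff i j k (l - 1) = k * ((j + 1) * k - l * i)"
    using False by (auto simp: B_coeff_def)
  moreover have "i * B_coeff k l i (j - 1) = i * ((l + 1) * i - j * k)"
    using False by (auto simp: B_coeff_def)
  ultimately show ?thesis
    by (simp add: algebra_simps)
qed

lemma B_coeff_bottom: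
  "((j + 1) * k - (l + 1) * i) * B_coeff (i + k) (j + l) (- k) (- 1 - l) =
   - B_coeff i j (- k) (- 1 - l) * B_coeff k l (i - k) (j - 1 - l)"
proof -
  consider "i = 0" "j = 0" | "\<not> (i = 0 \<and> j = 0)" "i = k" "j = l" |
    "\<not> (i = 0 \<and> j = 0)" "\<not> (i = k \<and> j = l)" "k = 0" "l = 0" |
    "\<not> (i = 0 \<and> j = 0)" "\<not> (i = k \<and> j = l)" "\<not> (k = 0 \<and> l = 0)"
    by blast
  then show ?thesis
  proof cases
    case 4
    have 1: "B_coeff (i + k) (j + l) (- k) (- 1 - l) = l * i - (j + 1) * k"
      using 4 by (auto simp: B_coeff_def algebra_simps)
    have 2: "B_coeff i j (- k) (- 1 - l) = l * i - (j + 1) * k"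
      using 4 by (auto simp: B_coeff_def algebra_simps)
    have 3: "B_coeff k l (i - k) (j - 1 - l) = (l + 1) * i - (j + 1) * k"
      using 4 by (auto simp: B_coeff_def algebra_simps)
    show ?thesis
      unfolding 1 2 3 by (simp add: algebra_simps)
  qed (auto simp: B_coeff_def algebra_simps)
qed

lemma B_coeff_module:
  "((j + 1) * k - (l + 1) * i) * B_coeff (i + k) (j + l) m n =
   B_coeff k l m n * B_coeff i j (k + m) (l + n) - B_coeff i j m n * B_coeff k l (i + m) (j + n)"
proof -
  consider "m = 0" "n = - 1" | "m = - k" "n = - 1 - l" | "m = - i" "n = - 1 - j" |
    "i + k + m = 0" "j + l + n = - 1" "\<not> (m = 0 \<and> n = - 1)" 
       "\<not> (k + m = 0 \<and> l + n = - 1)" "\<not> (i + m = 0 \<and> j + n = - 1)" |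
    "\<not> (i + k + m = 0 \<and> j + l + n = - 1)" "\<not> (m = 0 \<and> n = - 1)" 
       "\<not> (k + m = 0 \<and> l + n = - 1)" "\<not> (i + m = 0 \<and> j + n = - 1)"
    by linarith
  then show ?thesis
  proof cases
    case 1
    have "B_coeff i j 0 (- 1) = i" for i j
      by (simp add: B_coeff_def)
    then show ?thesis
      using B_coeff_top[of j k l i] 1 by simp
  next
    case 2
    have z: "B_coeff k l (- k) (- 1 - l) = 0"
      by (simp add: B_coeff_def)
    have s: "i + m = i - k" "j + n = j - 1 - l"
      using 2 by simp_all
    show ?thesis
      unfolding s unfolding 2 z using B_coeff_bottom[of j k l i] by simp
  next
    case 3
    have z: "B_coeff i j (- i) (- 1 - j) = 0"
      by (simp add: B_coeff_def)
    have s: "k + m = k - i" "l + n = l - 1 - j"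
      using 3 by simp_all
    have "((j + 1) * k - (l + 1) * i) * B_coeff (k + i) (l + j) (- i) (- 1 - j) =
        - (((l + 1) * i - (j + 1) * k) * B_coeff (k + i) (l + j) (- i) (- 1 - j))"
      by (simp add: algebra_simps)
    also have "\<dots> = B_coeff k l (- i) (- 1 - j) * B_coeff i j (k - i) (l - 1 - j)"
      unfolding B_coeff_bottom by simp
    finally show ?thesis
      unfolding s unfolding 3 z by (simp add: add.commute[of i k] add.commute[of j l])
  next
    case 4
    have "i + (k + m) = 0" "j + (l + n) = - 1" "k + (i + m) = 0" "l + (j + n) = - 1"
      using 4 by linarith+
    then show ?thesis
      unfolding B_coeff_def using 4 by (simp only: if_False if_True simp_thms mult_zero_right diff_self)
  next
    case 5
    have "\<not> (i + (k + m) = 0 \<and> j + (l + n) = - 1)" "\<not> (k + (i + m) = 0 \<and> l + (j + n) = - 1)"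
      using 5 by linarith+
    then show ?thesis
      unfolding B_coeff_def if_not_P[OF 5(1)] if_not_P[OF 5(2)] if_not_P[OF 5(3)] if_not_P[OF 5(4)]
      by (simp only: if_False) algebra
  qed
qed

lemma C_coeff_module:
  "((j + 1) * k - (l + 1) * i) * (if m = 0 \<and> n = - 2 then 0 else B_coeff (i + k) (j + l) m n) =
   (if m = 0 \<and> n = - 2 then 0 else B_coeff k l m n) *
     (if k + m = 0 \<and> l + n = - 2 then 0 else B_coeff i j (k + m) (l + n)) -
   (if m = 0 \<and> n = - 2 then 0 else B_coeff i j m n) *
     (if i + m = 0 \<and> j + n = - 2 then 0 else B_coeff k l (i + m) (j + n))"
proof (cases "m = 0 \<and> n = - 2")
  case True
  then show ?thesis
    by simp
next
  case False
  have "B_coeff k l m n * (if k + m = 0 \<and> l + n = - 2 then 0 else x) = B_coeff k l m n * x"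
    for k l x
    using B_coeff_zero[of k m l n] by simp
  then show ?thesis
    unfolding if_not_P[OF False] by (simp only: B_coeff_module)
qed

lemma C_coeff_cocycle:
  "((j + 1) * k - (l + 1) * i) * (if i + k + m = 0 \<and> j + l + n = - 2 then i + k else 0) =
   (if m = 0 \<and> n = - 2 then 0 else B_coeff k l m n) *
     (if i + (k + m) = 0 \<and> j + (l + n) = - 2 then i else 0) -
   (if m = 0 \<and> n = - 2 then 0 else B_coeff i j m n) *
     (if k + (i + m) = 0 \<and> l + (j + n) = - 2 then k else 0)"
proof (cases "i + k + m = 0 \<and> j + l + n = - 2")
  case True
  then have mn: "m = - i - k" "n = - 2 - j - l"
    by linarith+
  have "k + (i + m) = 0 \<and> l + (j + n) = - 2" "i + (k + m) = 0 \<and> j + (l + n) = - 2"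
    using True by linarith+
  note * = if_P[OF True] if_P[OF this(1)] if_P[OF this(2)]
  consider "k = - i" "l = - j" | "k = - i" "l = - 1 - j" | "i = 0" "j = - 1" | "k = 0" "l = - 1" |
    "\<not> (m = 0 \<and> n = - 2)" "\<not> (m = 0 \<and> n = - 1)"
    "\<not> (k + m = 0 \<and> l + n = - 1)" "\<not> (i + m = 0 \<and> j + n = - 1)"
    using mn by linarith
  then show ?thesis
  proof cases
    case 5
    have "((j + 1) * k - (l + 1) * i) * (i + k) =
        ((l + 1) * m - (n + 1) * k) * i - ((j + 1) * m - (n + 1) * i) * k"
      by (simp add: mn algebra_simps)
    then show ?thesis
      unfolding * B_coeff_def if_not_P[OF 5(1)] if_not_P[OF 5(2)] if_not_P[OF 5(3)] if_not_P[OF 5(4)] .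
  qed (unfold * mn, simp_all add: B_coeff_def algebra_simps)
next
  case False
  then have "\<not> (k + (i + m) = 0 \<and> l + (j + n) = - 2)" "\<not> (i + (k + m) = 0 \<and> j + (l + n) = - 2)"
    by linarith+
  then show ?thesis
    unfolding if_not_P[OF False] by (simp only: if_False mult_zero_right diff_self)
qed

lemma excluded_iff: "(k = - i \<and> l = - j - 1) = (i + k = 0 \<and> j + l = - 1)" for i j k l :: int
    by linarith

lemma B_coeff: "B_basis i j k l = scale (of_int (B_coeff i j k l)) (e (i + k) (j + l))"
proof (cases "(k, l) = (0, -1) \<or> (k, l) = (0, -2)")
  case True
  then show ?thesis
    by (elim disjE) (simp_all add: B_basis_def B_coeff_def)
next
  case False
  then show ?thesis
    unfolding B_basis_def B_coeff_def excluded_iff prod.inject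
    by (cases "i + k = 0 \<and> j + l = - 1")
       (simp_all only: de_Morgan_disj if_True if_False simp_thms of_int_0 bispace.scale_zero_left)
qed

lemma C_coeff:
  "C_basis i j k l =
     scale (of_int (if k = 0 \<and> l = - 2 then 0 else B_coeff i j k l)) (e (i + k) (j + l)) +
     scale (of_int (if i + k = 0 \<and> j + l = - 2 then i else 0)) (e 0 (- 2))"
proof (cases "(k, l) = (0, -1) \<or> (k, l) = (0, -2)")
  case True
  then show ?thesis
    by (elim disjE) (simp_all add: C_basis_def B_coeff_def)
next
  case False
  show ?thesis
  proof (cases "i + k = 0 \<and> j + l = - 1")
    case True
    then show ?thesis
      using False unfolding C_basis_def B_coeff_def excluded_iff prod.inject
      by simp
  next
    case nt: False
    with False show ?thesis
      unfolding C_basis_def B_coeff_def excluded_iff prod.inject add.commute[of l j]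
      by (cases "i + k = 0 \<and> j + l = - 2")
         (simp_all only: de_Morgan_disj if_True if_False simp_thms of_int_0 bispace.scale_zero_left)
  qed
qed

lemma lie_module_B: "lie_module scale L_bracket scale B_act"
  unfolding B_act_def
  by (rule lie_module_from_coefficients[where \<alpha> = B_coeff and \<gamma> = "\<lambda>i j k l. 0"])
     (simp_all add: B_coeff B_coeff_module)

lemma lie_module_C: "lie_module scale L_bracket scale C_act"
  unfolding C_act_def
proof (rule lie_module_from_coefficients
      [where \<alpha> = "\<lambda>i j k l. if k = 0 \<and> l = - 2 then 0 else B_coeff i j k l"
         and \<gamma> = "\<lambda>i j k l. if i + k = 0 \<and> j + l = - 2 then i else 0"], goal_cases)
  case 1
  show ?case
    by (rule C_coeff)
next
  case 2
  show ?case
    by (rule C_coeff_module)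
next
  case 3
  show ?case
    by (rule C_coeff_cocycle)
next
  case 4
  show ?case
    by (simp add: C_basis_def)
qed

end

theory Submission
  imports Defs
begin

text \<open>
  Put \<open>x = a + k\<close> and \<open>y = l + 1 - b\<close>.  Away from the points \<open>(x, y) = (0, 0)\<close> and \<open>(0, -1)\<close> all four
  modules have the same structure constants as \<open>A\<^bsub>a,b\<^esub>\<close>.  A submodule \<open>M\<close> containing a vector \<open>u\<close> with
  some other \<open>(x, y)\<close> in its support contains every basis vector off these two points: \<open>L\<^bsub>0,0\<^esub>\<close>
  separates the values of \<open>x\<close>; within a column \<open>x \<noteq> 0\<close> the operator
  \<open>L\<^bsub>-i,0\<^esub> L\<^bsub>i,0\<^esub> - L\<^bsub>-i,1\<^esub> L\<^bsub>i,-1\<^esub>\<close> has the eigenvalues \<open>x\<^sup>2 + xi + 2xiy\<close> and separates the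
  values of \<open>y\<close>, while a column \<open>x = 0\<close> is first moved by \<open>L\<^bsub>1,0\<^esub>\<close>; so \<open>M\<close> contains a basis vector, and
  from it any other one is reached in two steps.  The two exceptional points exist only for integral
  \<open>a\<close> and \<open>b\<close>, and there the arrows are read off the structure constants.
\<close>

section \<open>Generation and quotients\<close>

context lie_module
begin

section \<open>Submodules generated by a set\<close>

lemma submodule_subspace: "submodule M \<Longrightarrow> V.subspace M"
  by (simp add: submodule_def)

lemma submodule_act: "submodule M \<Longrightarrow> v \<in> M \<Longrightarrow> act x v \<in> M"
  by (simp add: submodule_def)

lemma act_zero_right: "act x 0 = 0"
  using act_scale_right[of x 0 0] by simp

lemma foldr_act_mem: "submodule M \<Longrightarrow> v \<in> M \<Longrightarrow> foldr act xs v \<in> M"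
  by (induction xs) (auto intro: submodule_act)

text \<open>Acting with \<open>x\<close> on a product prepends one letter to the word, and linearity
  carries this over to the span.\<close>

lemma submodule_env_span: "submodule (env_span S)"
  unfolding submodule_def
proof (intro conjI allI ballI)
  show "V.subspace (env_span S)"
    unfolding env_span_def by (rule V.subspace_span)
  fix x v
  assume "v \<in> env_span S"
  then show "act x v \<in> env_span S"
    unfolding env_span_def
  proof (induction rule: V.span_induct_alt)
    case base
    show ?case
      by (simp add: act_zero_right V.span_zero)
  next
    case (step c u w)
    from step(1) obtain xs v where u: "u = foldr act xs v" "v \<in> S"
      by blast
    then have "act x u = foldr act (x # xs) v"
      by simp
    with u(2) have "act x u \<in> {foldr act xs v |xs v. v \<in> S}"
      by blast
    with step show ?case
      by (simp add: act_add_right act_scale_right V.span_add V.span_scale V.span_base)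
  qed
qed

lemma subset_env_span: "S \<subseteq> env_span S"
proof
  fix v
  assume "v \<in> S"
  then have "foldr act [] v \<in> {foldr act xs v |xs v. v \<in> S}"
    by blast
  then show "v \<in> env_span S"
    unfolding env_span_def by (simp add: V.span_base)
qed

text \<open>\<open>env_span S\<close> is the least submodule containing \<open>S\<close>. Generation
  can therefore be tested on submodules alone, and words in the Lie algebra do not occur
  again.\<close>

lemma generates_iff: "generates S T \<longleftrightarrow> (\<forall>M. submodule M \<longrightarrow> S \<subseteq> M \<longrightarrow> T \<subseteq> M)"
proof
  assume gen: "generates S T"
  have "env_span S \<subseteq> M" if "submodule M" "S \<subseteq> M" for M
    unfolding env_span_def using that
    by (intro V.span_minimal) (auto intro: foldr_act_mem submodule_subspace)
  with gen show "\<forall>M. submodule M \<longrightarrow> S \<subseteq> M \<longrightarrow> T \<subseteq> M"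
    unfolding generates_def by blast
next
  assume "\<forall>M. submodule M \<longrightarrow> S \<subseteq> M \<longrightarrow> T \<subseteq> M"
  then show "generates S T"
    unfolding generates_def using submodule_env_span subset_env_span by blast
qed

section \<open>Cosets and irreducible subquotients\<close>

lemma coset_eq_iff:
  assumes "V.subspace N"
  shows "coset N u = coset N v \<longleftrightarrow> u - v \<in> N"
proof
  assume "coset N u = coset N v"
  moreover have "u + 0 \<in> coset N u"
    unfolding coset_def using V.subspace_0[OF assms] by blast
  ultimately obtain n where "u = v + n" "n \<in> N"
    unfolding coset_def by auto
  then show "u - v \<in> N"
    by simp
next
  assume uv: "u - v \<in> N"
  have "u + n \<in> coset N v" "v + n \<in> coset N u" if "n \<in> N" for n
  proof -
    have "u + n = v + ((u - v) + n)" "v + n = u + (n - (u - v))"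
      by simp_all
    with that show "u + n \<in> coset N v" "v + n \<in> coset N u"
      unfolding coset_def
      using V.subspace_add[OF assms uv that] V.subspace_diff[OF assms that uv] by blast+
  qed
  then show "coset N u = coset N v"
    unfolding coset_def[of N u] coset_def[of N v] unfolding coset_def by blast
qed

lemma coset_zero: "coset N 0 = N"
  by (simp add: coset_def)

lemma coset_eq_self_iff: "V.subspace N \<Longrightarrow> coset N v = N \<longleftrightarrow> v \<in> N"
  using coset_eq_iff[of N v 0] by (simp add: coset_zero)

text \<open>Correspondence theorem: a submodule \<open>Q\<close> of the quotient is the image of its
  preimage \<open>P\<close>, which is a submodule between \<open>N\<close> and
  \<open>M\<close>.\<close>

lemma irreducible_quotientI:
  assumes N: "submodule N" and M: "submodule M" and NM: "N \<subset> M"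
    and between: "\<And>P. submodule P \<Longrightarrow> N \<subseteq> P \<Longrightarrow> P \<subseteq> M \<Longrightarrow> P = N \<or> P = M"
  shows "irreducible_quotient M N"
  unfolding irreducible_quotient_def
proof (intro conjI allI impI)
  note sN = submodule_subspace[OF N] and sM = submodule_subspace[OF M]
  from NM obtain m where "m \<in> M" "m \<notin> N"
    by blast
  then show "quotient M N \<noteq> {N}"
    unfolding quotient_def using coset_eq_self_iff[OF sN] by blast
  fix Q
  assume "submodule_of_quotient M N Q"
  then have sub: "Q \<subseteq> quotient M N" and zero: "N \<in> Q"
    and add: "\<And>u v. \<lbrakk>u \<in> M; v \<in> M; coset N u \<in> Q; coset N v \<in> Q\<rbrakk> \<Longrightarrow> coset N (u + v) \<in> Q"
    and scale: "\<And>c v. \<lbrakk>v \<in> M; coset N v \<in> Q\<rbrakk> \<Longrightarrow> coset N (scaleV c v) \<in> Q"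
    and act: "\<And>x v. \<lbrakk>v \<in> M; coset N v \<in> Q\<rbrakk> \<Longrightarrow> coset N (act x v) \<in> Q"
    unfolding submodule_of_quotient_def by blast+
  define P where "P = {v \<in> M. coset N v \<in> Q}"
  have Q: "Q = coset N ` P"
    using sub unfolding P_def quotient_def by blast
  have "submodule P"
    unfolding submodule_def P_def using zero add scale act sM M
    by (auto intro!: V.subspaceI simp: coset_zero V.subspace_0 V.subspace_add V.subspace_scale
        submodule_act)
  moreover have "N \<subseteq> P"
    unfolding P_def using NM zero by (auto simp: coset_eq_self_iff[OF sN, THEN iffD2])
  moreover have "P \<subseteq> M"
    unfolding P_def by blast
  ultimately consider "P = N" | "P = M"
    using between by blast
  then show "Q = {N} \<or> Q = quotient M N"
  proof cases
    case 1
    then have "Q \<subseteq> {N}"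
      unfolding Q using coset_eq_self_iff[OF sN] by blast
    with zero show ?thesis
      by blast
  next
    case 2
    then show ?thesis
      by (simp add: Q quotient_def)
  qed
qed

text \<open>A complement of \<open>N\<close> in \<open>M\<close> represents every coset exactly
  once: trivial intersection gives injectivity, the decomposition of \<open>v\<close> gives
  surjectivity.\<close>

lemma correspondsI:
  assumes W: "V.subspace W" and N: "V.subspace N" and "W \<subseteq> M"
    and trivial: "W \<inter> N \<subseteq> {0}" and sum: "\<And>v. v \<in> M \<Longrightarrow> \<exists>w\<in>W. v - w \<in> N"
  shows "corresponds W M N"
  unfolding corresponds_def
proof (intro conjI bij_betwI')
  fix u v
  assume "u \<in> W" "v \<in> W"
  then show "coset N u = coset N v \<longleftrightarrow> u = v"
    using trivial V.subspace_diff[OF W, of u v] V.subspace_0[OF N] by (auto simp: coset_eq_iff[OF N])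
next
  fix X
  assume "X \<in> quotient M N"
  then obtain v where "X = coset N v" "v \<in> M"
    unfolding quotient_def by blast
  then show "\<exists>w\<in>W. X = coset N w"
    using sum[of v] coset_eq_iff[OF N] by blast
qed (use assms in \<open>auto simp: quotient_def\<close>)

end

section \<open>Coordinate subspaces and separation of eigenvalues\<close>

section \<open>Supports\<close>

text \<open>Spans of basis vectors, encoded by keys so that inclusions and complements reduce to the
  index sets; \<open>span_basis\<close> gives the link to spans.\<close>

definition supported :: "(int \<times> int) set \<Rightarrow> 'f::field bispace set" where
  "supported X = {u. Poly_Mapping.keys u \<subseteq> X}"

lemma lookup_e: "Poly_Mapping.lookup (e k l) p = (if p = (k, l) then 1 else 0)"
  by (auto simp: e_def lookup_single when_def)

lemma keys_e [simp]: "Poly_Mapping.keys (e k l :: 'f::field bispace) = {(k, l)}"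
  by (auto simp: in_keys_iff lookup_e split: if_splits)

lemma keys_scale: "Poly_Mapping.keys (scale c u) = (if c = 0 then {} else Poly_Mapping.keys u)"
  by (auto simp: in_keys_iff)

lemma subspace_supported: "bispace.subspace (supported X :: 'f::field bispace set)"
proof (rule bispace.subspaceI)
  fix u v :: "'f bispace" and c
  assume "u \<in> supported X" "v \<in> supported X"
  then show "u + v \<in> supported X" "scale c u \<in> supported X"
    using keys_add[of u v] by (auto simp: supported_def keys_scale)
qed (simp add: supported_def)

lemma bispace_sum:
  "u = (\<Sum>p\<in>Poly_Mapping.keys u. scale (Poly_Mapping.lookup u p) (e (fst p) (snd p)))"
proof (rule poly_mapping_eqI)
  fix q
  show "Poly_Mapping.lookup u q = Poly_Mapping.lookup
      (\<Sum>p\<in>Poly_Mapping.keys u. scale (Poly_Mapping.lookup u p) (e (fst p) (snd p))) q"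
    by (simp add: lookup_sum lookup_e if_distrib cong: if_cong)
       (simp add: in_keys_iff)
qed

lemma supported_subset_iff:
  fixes M :: "'f::field bispace set"
  assumes M: "bispace.subspace M"
  shows "supported X \<subseteq> M \<longleftrightarrow> (\<forall>k l. (k, l) \<in> X \<longrightarrow> e k l \<in> M)"
proof
  assume *: "\<forall>k l. (k, l) \<in> X \<longrightarrow> e k l \<in> M"
  show "supported X \<subseteq> M"
  proof
    fix u :: "'f bispace"
    assume "u \<in> supported X"
    with * show "u \<in> M"
      by (subst bispace_sum)
         (intro bispace.subspace_sum[OF M] bispace.subspace_scale[OF M], auto simp: supported_def)
  qed
qed (auto simp: supported_def)

lemma span_basis: "bispace.span {e k l | k l. (k, l) \<in> X} = (supported X :: 'f::field bispace set)"
proof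
  show "bispace.span {e k l | k l. (k, l) \<in> X} \<subseteq> (supported X :: 'f bispace set)"
    by (rule bispace.span_minimal[OF _ subspace_supported]) (auto simp: supported_def)
  show "supported X \<subseteq> (bispace.span {e k l | k l. (k, l) \<in> X} :: 'f bispace set)"
    unfolding supported_subset_iff[OF bispace.subspace_span] by (auto intro: bispace.span_base)
qed

lemma span_basis_single: "bispace.span {e k l :: 'f::field bispace} = supported {(k, l)}"
  unfolding span_basis[symmetric] by simp

lemma supported_mono_iff [simp]:
  "(supported X :: 'f::field bispace set) \<subseteq> supported Y \<longleftrightarrow> X \<subseteq> Y"
  unfolding supported_subset_iff[OF subspace_supported] by (auto simp: supported_def)

lemma supported_eq_iff [simp]:
  "(supported X :: 'f::field bispace set) = supported Y \<longleftrightarrow> X = Y"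
  by (metis supported_mono_iff subset_antisym order_refl)

lemma supported_empty: "supported {} = {0}"
  by (auto simp: supported_def)

lemma supported_UNIV: "supported UNIV = UNIV"
  by (auto simp: supported_def)

text \<open>\<open>w\<close> keeps exactly the coefficients of \<open>u\<close> outside
  \<open>X\<close>. For \<open>X\<close> inside \<open>Y\<close> this makes
  \<open>supported (Y - X)\<close> a complement of \<open>supported X\<close> in
  \<open>supported Y\<close>.\<close>

lemma supported_split:
  fixes u :: "'f::field bispace"
  assumes "u \<in> supported Y"
  shows "\<exists>w\<in>supported (Y - X). u - w \<in> supported X"
proof -
  define w where "w = (\<Sum>p\<in>Poly_Mapping.keys u - X.
      scale (Poly_Mapping.lookup u p) (e (fst p) (snd p)))"
  have w: "Poly_Mapping.lookup w q = (if q \<in> X then 0 else Poly_Mapping.lookup u q)" for q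
    unfolding w_def
    by (simp add: lookup_sum lookup_e if_distrib cong: if_cong) (simp add: in_keys_iff)
  have "w \<in> supported (Y - X)"
    using assms by (auto simp: supported_def in_keys_iff w split: if_splits)
  moreover have "u - w \<in> supported X"
    by (auto simp: supported_def in_keys_iff lookup_minus w split: if_splits)
  ultimately show ?thesis
    by blast
qed

text \<open>
  A key \<open>p\<close> with \<open>\<nu> p \<noteq> \<nu> q\<close> is removed by \<open>T - \<nu> p\<close>, which keeps \<open>q\<close>.
\<close>

lemma eigenvalue_separation:
  fixes T :: "'f::field bispace \<Rightarrow> 'f bispace"
  assumes M: "bispace.subspace M" and closed: "\<And>u. u \<in> M \<Longrightarrow> T u \<in> M"
    and add: "\<And>u v. T (u + v) = T u + T v" and scale: "\<And>c u. T (scale c u) = scale c (T u)"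
    and diag: "\<And>k l. (k, l) \<in> K \<Longrightarrow> T (e k l) = scale (\<nu> (k, l)) (e k l)"
    and "u \<in> M" "u \<in> supported K" "q \<in> Poly_Mapping.keys u"
  shows "\<exists>v\<in>M. Poly_Mapping.keys v \<subseteq> {p \<in> Poly_Mapping.keys u. \<nu> p = \<nu> q} \<and>
    q \<in> Poly_Mapping.keys v"
  using assms(6-)
\<comment> \<open>The measure counts the keys whose eigenvalue differs from that of
  \<open>q\<close>; each round removes at least one of them and creates no new key.\<close>
proof (induction "card {p \<in> Poly_Mapping.keys u. \<nu> p \<noteq> \<nu> q}" arbitrary: u rule: less_induct)
  case (less u)
  have T: "Poly_Mapping.lookup (T u) p = \<nu> p * Poly_Mapping.lookup u p" if "u \<in> supported K" for u p
  proof -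
    have "T 0 = 0"
      using scale[of 0 0] by simp
    from that show ?thesis
      unfolding span_basis[symmetric]
    proof (induction rule: bispace.span_induct_alt)
      case (step c u v)
      then obtain k l where "u = e k l" "(k, l) \<in> K"
        by blast
      then have "Poly_Mapping.lookup (T u) p = \<nu> p * Poly_Mapping.lookup u p"
        by (simp add: diag lookup_e)
      then show ?case
        by (simp add: add scale lookup_add step ring_distribs mult.left_commute)
    qed (simp add: \<open>T 0 = 0\<close>)
  qed
  show ?case
  proof (cases "\<forall>p\<in>Poly_Mapping.keys u. \<nu> p = \<nu> q")
    case True
    with less.prems show ?thesis
      by blast
  next
    case False
    then obtain p where p: "p \<in> Poly_Mapping.keys u" "\<nu> p \<noteq> \<nu> q"
      by blast
    define w where "w = T u - scale (\<nu> p) u"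
    have w: "Poly_Mapping.lookup w r = (\<nu> r - \<nu> p) * Poly_Mapping.lookup u r" for r
      by (simp add: w_def lookup_minus T less.prems algebra_simps)
    have keys: "Poly_Mapping.keys w \<subseteq> Poly_Mapping.keys u" "p \<notin> Poly_Mapping.keys w"
      "q \<in> Poly_Mapping.keys w"
      using less.prems p by (auto simp: in_keys_iff w)
    have "w \<in> M"
      unfolding w_def using less.prems(1)
      by (intro bispace.subspace_diff[OF M] bispace.subspace_scale[OF M] closed)
    moreover have "w \<in> supported K"
      using less.prems(2) keys(1) by (simp add: supported_def)
    moreover have "card {r \<in> Poly_Mapping.keys w. \<nu> r \<noteq> \<nu> q} < card {r \<in> Poly_Mapping.keys u. \<nu> r \<noteq> \<nu> q}"
      using p keys by (intro psubset_card_mono) auto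
    ultimately show ?thesis
      using less.hyps[of w] keys by blast
  qed
qed

section \<open>Single keys, integer points off lines, closure of a chain\<close>

lemma scale_mem_iff:
  assumes "bispace.subspace M" "c \<noteq> 0"
  shows "scale c u \<in> M \<longleftrightarrow> u \<in> M"
proof
  assume "scale c u \<in> M"
  then have "scale (inverse c) (scale c u) \<in> M"
    by (rule bispace.subspace_scale[OF assms(1)])
  with assms(2) show "u \<in> M"
    by simp
qed (rule bispace.subspace_scale[OF assms(1)])

lemma mem_of_keys_singleton:
  fixes u :: "'f::field bispace"
  assumes M: "bispace.subspace M" "u \<in> M" and keys: "Poly_Mapping.keys u = {(k, l)}"
  shows "e k l \<in> M"
proof -
  have "u = scale (Poly_Mapping.lookup u (k, l)) (e k l)"
    using bispace_sum[of u] by (simp add: keys)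
  moreover have "Poly_Mapping.lookup u (k, l) \<noteq> 0"
    using keys by (metis in_keys_iff singletonI)
  ultimately show ?thesis
    using scale_mem_iff[OF M(1)] M(2) by metis
qed

text \<open>If \<open>B = 0\<close>, the line excludes at most one \<open>i\<close>; otherwise every
  \<open>i\<close> leaves at most one bad \<open>j\<close>. The nested form, with one exception at
  each level, lets two such conditions be combined.\<close>

lemma int_avoiding_line:
  fixes A B C :: "'f::field_char_0"
  assumes "A \<noteq> 0 \<or> B \<noteq> 0"
  shows "\<exists>i0::int. \<forall>i. i \<noteq> i0 \<longrightarrow> (\<exists>j0::int. \<forall>j. j \<noteq> j0 \<longrightarrow> A * of_int i + B * of_int j + C \<noteq> 0)"
proof (cases "B = 0")
  case True
  then have "A \<noteq> 0"
    using assms by simp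
  have "\<exists>i0::int. \<forall>i. i \<noteq> i0 \<longrightarrow> A * of_int i + C \<noteq> 0"
  proof (cases "\<exists>i0::int. A * of_int i0 + C = 0")
    case True
    then obtain i0 :: int where "A * of_int i0 + C = 0" ..
    then have "A * of_int i + C = A * of_int (i - i0)" for i
      by (simp add: algebra_simps eq_neg_iff_add_eq_0)
    with \<open>A \<noteq> 0\<close> show ?thesis
      by (metis mult_eq_0_iff of_int_eq_0_iff right_minus_eq)
  qed blast
  then show ?thesis
    unfolding True mult_zero_left add_0_right by meson
next
  case False
  have "\<exists>j0::int. \<forall>j. j \<noteq> j0 \<longrightarrow> A * of_int i + B * of_int j + C \<noteq> 0" for i :: int
  proof (cases "\<exists>j0::int. A * of_int i + B * of_int j0 + C = 0")
    case True
    then obtain j0 :: int where "A * of_int i + B * of_int j0 + C = 0" ..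
    then have "A * of_int i + B * of_int j + C = B * of_int (j - j0)" for j
      by (simp add: algebra_simps eq_neg_iff_add_eq_0)
    with False show ?thesis
      by (metis mult_eq_0_iff of_int_eq_0_iff right_minus_eq)
  qed blast
  then show ?thesis
    by blast
qed

text \<open>First \<open>i\<close> avoids one exception for each line, then \<open>j\<close> avoids
  one exception for each line.\<close>

lemma int_avoiding_two_lines:
  fixes A B C A' B' C' :: "'f::field_char_0"
  assumes "A \<noteq> 0 \<or> B \<noteq> 0" "A' \<noteq> 0 \<or> B' \<noteq> 0"
  shows "\<exists>i j :: int. A * of_int i + B * of_int j + C \<noteq> 0 \<and> A' * of_int i + B' * of_int j + C' \<noteq> 0"
proof -
  have avoid: "\<exists>i. i \<noteq> p \<and> i \<noteq> q \<and> i \<noteq> r" for p q r :: int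
    by (rule exI[of _ "\<bar>p\<bar> + \<bar>q\<bar> + \<bar>r\<bar> + 1"]) linarith
  show ?thesis
    using int_avoiding_line[OF assms(1), of C] int_avoiding_line[OF assms(2), of C'] avoid by metis
qed

text \<open>Lists the arrows implied by a chain, so that generation can be compared with them pair
  by pair.\<close>

lemma trancl_two_steps:
  assumes "x \<noteq> y" "y \<noteq> z" "x \<noteq> z"
  shows "{(x, y), (y, z)}\<^sup>+ = {(x, y), (y, z), (x, z)}"
proof
  have "trans {(x, y), (y, z), (x, z)}"
    using assms by (auto intro: transI)
  then show "{(x, y), (y, z)}\<^sup>+ \<subseteq> {(x, y), (y, z), (x, z)}"
    using trancl_mono[of _ "{(x, y), (y, z)}" "{(x, y), (y, z), (x, z)}"] trancl_id by fastforce
qed (auto intro: trancl_trans)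

section \<open>Submodules in the common setting of the four modules\<close>

section \<open>Modules that agree with \<open>A\<^bsub>a,b\<^esub>\<close> off the exceptional points\<close>

text \<open>The conditions are equations in the field, so integrality of \<open>a\<close> and
  \<open>b\<close> is not presupposed; the set is empty unless both are integers.\<close>

definition exceptional :: "'f::field_char_0 \<Rightarrow> 'f \<Rightarrow> (int \<times> int) set" where
  "exceptional a b = {(k, l). a + of_int k = 0 \<and> (of_int l = b - 1 \<or> of_int l = b - 2)}"

text \<open>Transitions that start or end at an exceptional point are where the four modules differ;
  apart from \<open>weight\<close>, only their support is constrained. \<open>weight\<close> covers
  all indices, so columns can be separated in the whole module.\<close>

locale modified_Aab =
  lie_module "scale :: 'f::field_char_0 \<Rightarrow> 'f bispace \<Rightarrow> 'f bispace" L_bracket scale "bilin_ext \<beta>"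
  for \<beta> :: "int \<Rightarrow> int \<Rightarrow> int \<Rightarrow> int \<Rightarrow> 'f::field_char_0 bispace" +
  fixes a b :: 'f
  assumes generic: "\<And>i j k l. (k, l) \<notin> exceptional a b \<Longrightarrow> (i + k, j + l) \<notin> exceptional a b \<Longrightarrow>
      \<beta> i j k l = Aab_basis a b i j k l"
    and weight: "\<And>k l. \<beta> 0 0 k l = scale (a + of_int k) (e k l)"
    and keys_basis: "\<And>i j k l. Poly_Mapping.keys (\<beta> i j k l) \<subseteq> insert (i + k, j + l) (exceptional a b)"
begin

text \<open>By \<open>keys_basis\<close>, a key of \<open>u\<close> other than
  \<open>(k - i, l - j)\<close> can contribute only at its own target or at exceptional points,
  hence not at \<open>(k, l)\<close>.\<close>

lemma lookup_act:
  assumes "(k, l) \<notin> exceptional a b"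
  shows "Poly_Mapping.lookup (bilin_ext \<beta> (e i j) u) (k, l) =
    Poly_Mapping.lookup u (k - i, l - j) * Poly_Mapping.lookup (\<beta> i j (k - i) (l - j)) (k, l)"
proof (induction u rule: bispace_induct)
  case (basis m n)
  have "Poly_Mapping.lookup (\<beta> i j m n) (k, l) = 0" if "(m, n) \<noteq> (k - i, l - j)"
  proof -
    have "(k, l) \<notin> Poly_Mapping.keys (\<beta> i j m n)"
      using keys_basis[of i j m n] assms that by auto
    then show ?thesis
      by (simp add: in_keys_iff)
  qed
  then show ?case
    by (auto simp: bilin_ext_e lookup_e)
qed (simp_all add: bilin_ext_linear lookup_add algebra_simps)

lemma act_e:
  assumes "a + of_int k \<noteq> 0" "a + of_int i + of_int k \<noteq> 0"
  shows "bilin_ext \<beta> (e i j) (e k l) = Aab_basis a b i j k l"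
  using assms by (simp add: bilin_ext_e generic exceptional_def add.assoc)

lemma basis_mem_of_column:
  assumes M: "submodule M" and u: "u \<in> M" "u \<in> supported {(k', l'). k' = k}"
    and q: "(k, l) \<in> Poly_Mapping.keys u" and k: "a + of_int k \<noteq> 0"
  shows "e k l \<in> M"
proof -
  note sM = submodule_subspace[OF M]
  define x where "x = a + of_int k"
  have "x \<noteq> 0"
    using k by (simp add: x_def)
  \<comment> \<open>The passage through column \<open>k + i\<close> must avoid \<open>x = 0\<close>,
    where structure constants may be modified. \<open>i = 1\<close> serves unless
    \<open>x = -1\<close>, and then \<open>i = -1\<close> does.\<close>
  obtain i :: int where i: "i \<noteq> 0" "x + of_int i \<noteq> 0"
  proof (cases "x + 1 = 0")
    case True
    then have "x = - 1"
      by (simp add: eq_neg_iff_add_eq_0)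
    then show ?thesis
      using that[of "-1"] by simp
  qed (use that[of 1] in simp)
  define T where "T v = bilin_ext \<beta> (e (- i) 0) (bilin_ext \<beta> (e i 0) v) -
    bilin_ext \<beta> (e (- i) 1) (bilin_ext \<beta> (e i (- 1)) v)" for v
  define \<mu> where "\<mu> = (\<lambda>(k' :: int, l' :: int). x^2 + x * of_int i + 2 * x * of_int i * (of_int l' + 1 - b))"
  have "T v \<in> M" if "v \<in> M" for v
    unfolding T_def using that by (intro bispace.subspace_diff[OF sM] submodule_act[OF M])
  moreover have "T (v + w) = T v + T w" "T (scale c v) = scale c (T v)" for c v w
    by (simp_all add: T_def bilin_ext_linear bispace.scale_right_diff_distrib)
  moreover have "T (e k' l') = scale (\<mu> (k', l')) (e k' l')" if "(k', l') \<in> {(k', l'). k' = k}" for k' l'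
  proof -
    have act: "bilin_ext \<beta> (e i j) (e k l') =
        scale ((of_int j + 1) * x + (b - 1 - of_int l') * of_int i) (e (i + k) (j + l'))"
      "bilin_ext \<beta> (e (- i) j) (e (i + k) l') =
        scale ((of_int j + 1) * (x + of_int i) - (b - 1 - of_int l') * of_int i) (e k (j + l'))" for j l'
      using k i by (simp_all add: x_def act_e Aab_basis_def algebra_simps)
    \<comment> \<open>The terms quadratic in \<open>y\<close> cancel between the two products,
      leaving an expression affine in \<open>y\<close>.\<close>
    have eigenvalue: "(x + (b - 1 - y) * of_int i) * (x + of_int i - (b - 1 - y) * of_int i) -
        (b - 1 - y) * of_int i * (2 * x + 2 * of_int i - (b - y) * of_int i) =
        x^2 + x * of_int i + 2 * x * of_int i * (y + 1 - b)" for y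
      by (simp add: algebra_simps power2_eq_square)
    show ?thesis
      using that eigenvalue[of "of_int l'"]
      by (simp add: T_def act bilin_ext_linear \<mu>_def flip: bispace.scale_left_diff_distrib)
  qed
  ultimately obtain v where v: "v \<in> M" "(k, l) \<in> Poly_Mapping.keys v"
    "Poly_Mapping.keys v \<subseteq> {p \<in> Poly_Mapping.keys u. \<mu> p = \<mu> (k, l)}"
    using eigenvalue_separation[OF sM, of T "{(k', l'). k' = k}" \<mu> u "(k, l)"] u q by blast
  \<comment> \<open>The eigenvalue has slope \<open>2 * x * i\<close> in the second index. This is
    nonzero, so within the column it determines the index.\<close>
  have "Poly_Mapping.keys v \<subseteq> {(k, l)}"
    using v(3) u(2) \<open>x \<noteq> 0\<close> i(1) by (auto simp: supported_def \<mu>_def)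
  with v show ?thesis
    by (intro mem_of_keys_singleton[OF sM]) auto
qed

text \<open>In characteristic zero the weights \<open>a + k\<close> of distinct columns differ, so
  separation with \<open>e 0 0\<close> isolates one column; exceptional keys are included.\<close>

lemma column_component:
  assumes M: "submodule M" and u: "u \<in> M" "(k, l) \<in> Poly_Mapping.keys u"
  shows "\<exists>v\<in>M. v \<in> supported {(k', l'). k' = k} \<and> (k, l) \<in> Poly_Mapping.keys v"
proof -
  define \<mu> where "\<mu> = (\<lambda>(k' :: int, l' :: int). a + of_int k')"
  have "\<exists>v\<in>M. Poly_Mapping.keys v \<subseteq> {p \<in> Poly_Mapping.keys u. \<mu> p = \<mu> (k, l)} \<and>
      (k, l) \<in> Poly_Mapping.keys v"
    using u submodule_act[OF M]
    by (intro eigenvalue_separation[OF submodule_subspace[OF M], where T = "bilin_ext \<beta> (e 0 0)" and K = UNIV])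
       (auto simp: bilin_ext_linear bilin_ext_e weight \<mu>_def supported_UNIV)
  then show ?thesis
    by (fastforce simp: supported_def \<mu>_def)
qed

lemma basis_mem:
  assumes M: "submodule M" and u: "u \<in> M" "(k, l) \<in> Poly_Mapping.keys u" and k: "a + of_int k \<noteq> 0"
  shows "e k l \<in> M"
  using column_component[OF M u] basis_mem_of_column[OF M _ _ _ k] by blast

lemma regular_basis_mem:
  assumes M: "submodule M" and u: "u \<in> M" "q \<in> Poly_Mapping.keys u" "q \<notin> exceptional a b"
  shows "\<exists>k l. a + of_int k \<noteq> 0 \<and> e k l \<in> M"
proof -
  obtain k l where q: "q = (k, l)"
    by fastforce
  show ?thesis
  proof (cases "a + of_int k = 0")
    case False
    then show ?thesis
      using basis_mem[OF M] u unfolding q by blast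
  next
    case True
    then have k: "a + of_int (1 + k) \<noteq> 0"
      by (simp add: add.left_commute)
    then have "(1 + k, l) \<notin> exceptional a b"
      by (simp add: exceptional_def)
    \<comment> \<open>In the column \<open>x = 0\<close> the structure constant of
      \<open>e 1 0\<close> is \<open>b - 1 - l\<close>; regularity of \<open>q\<close> makes it
      nonzero.\<close>
    moreover have "of_int l \<noteq> b - 1"
      using u(3) True by (simp add: q exceptional_def)
    ultimately have "(1 + k, l) \<in> Poly_Mapping.keys (bilin_ext \<beta> (e 1 0) u)"
      using u(2,3) True generic[of k l 1 0]
      by (simp add: q in_keys_iff lookup_act Aab_basis_def lookup_e)
    then have "e (1 + k) l \<in> M"
      using basis_mem[OF M submodule_act[OF M u(1)]] k by blast
    with k show ?thesis
      by blast
  qed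
qed

text \<open>
  In the coordinates \<open>x = a + k\<close>, \<open>y = l + 1 - b\<close> the basis vector at \<open>(x, y)\<close> is sent to a nonzero
  multiple of the one at \<open>(x', y')\<close> iff \<open>x (y' + 1) \<noteq> x' y\<close>.  So a two-step path
  only has to pass through a point off two lines; they are not the whole plane because \<open>x \<noteq> 0\<close> and
  \<open>(x', y' + 1) \<noteq> (0, 0)\<close>.
\<close>

lemma basis_step:
  assumes M: "submodule M" "e k l \<in> M" and "(k, l) \<notin> exceptional a b" "(k', l') \<notin> exceptional a b"
    and neq: "(a + of_int k) * (of_int l' + 2 - b) \<noteq> (a + of_int k') * (of_int l + 1 - b)"
  shows "e k' l' \<in> M"
proof -
  have "bilin_ext \<beta> (e (k' - k) (l' - l)) (e k l) = scale ((a + of_int k) * (of_int l' + 2 - b) -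
      (a + of_int k') * (of_int l + 1 - b)) (e k' l')"
    using assms by (simp add: bilin_ext_e generic Aab_basis_def algebra_simps)
  then show ?thesis
    using neq submodule_act[OF M, of "e (k' - k) (l' - l)"]
    by (simp add: scale_mem_iff[OF submodule_subspace[OF M(1)]])
qed

lemma all_regular_basis_mem:
  assumes M: "submodule M" and u: "u \<in> M" "q \<in> Poly_Mapping.keys u" "q \<notin> exceptional a b"
    and p: "(k', l') \<notin> exceptional a b"
  shows "e k' l' \<in> M"
proof -
  obtain k l where kl: "a + of_int k \<noteq> 0" "e k l \<in> M"
    using regular_basis_mem[OF M u] by blast
  define x where "x = a + of_int k"
  define y where "y = of_int l + 1 - b"
  define x' where "x' = a + of_int k'"
  define z where "z = of_int l' + 2 - b"
  \<comment> \<open>Both coefficients would vanish only for \<open>x' = 0\<close> and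
    \<open>l' = b - 2\<close>, which is an exceptional point.\<close>
  have "z \<noteq> 0 \<or> - x' \<noteq> 0"
    using p by (auto simp: exceptional_def x'_def z_def add_eq_0_iff)
  moreover have "- y \<noteq> 0 \<or> x \<noteq> 0"
    using kl(1) by (simp add: x_def)
  ultimately obtain i j :: int where
    "- y * of_int i + x * of_int j + (x * (2 - b) - a * y) \<noteq> 0"
    "z * of_int i + - x' * of_int j + (a * z - x' * (1 - b)) \<noteq> 0"
    using int_avoiding_two_lines by metis
  moreover have "x * (of_int j + 2 - b) - (a + of_int i) * y =
      - y * of_int i + x * of_int j + (x * (2 - b) - a * y)"
    "(a + of_int i) * z - x' * (of_int j + 1 - b) =
      z * of_int i + - x' * of_int j + (a * z - x' * (1 - b))"
    by (simp_all add: algebra_simps)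
  ultimately have ij: "x * (of_int j + 2 - b) \<noteq> (a + of_int i) * y"
    "(a + of_int i) * z \<noteq> x' * (of_int j + 1 - b)"
    by (metis right_minus_eq)+
  \<comment> \<open>The intermediate point is automatically regular: \<open>j = b - 2\<close> in the
    column \<open>x = 0\<close> would violate the first inequality, \<open>j = b - 1\<close> the
    second.\<close>
  have reg: "(i, j) \<notin> exceptional a b"
  proof
    assume "(i, j) \<in> exceptional a b"
    then have "a + of_int i = 0" "of_int j + 1 - b = 0 \<or> of_int j + 2 - b = 0"
      by (auto simp: exceptional_def)
    with ij show False
      by auto
  qed
  have "(k, l) \<notin> exceptional a b"
    using kl(1) by (simp add: exceptional_def)
  from basis_step[OF M kl(2) this reg] have "e i j \<in> M"
    using ij(1) unfolding x_def y_def .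
  from basis_step[OF M this reg p] show ?thesis
    using ij(2) unfolding x'_def z_def .
qed

section \<open>Coordinate submodules and composition series\<close>

lemma submodule_supported:
  assumes closed: "\<And>i j k l. (k, l) \<in> X \<Longrightarrow> Poly_Mapping.keys (\<beta> i j k l) \<subseteq> X"
  shows "submodule (supported X)"
  unfolding submodule_def
proof (intro conjI allI ballI subspace_supported)
  note add = bispace.subspace_add[OF subspace_supported]
    and scale = bispace.subspace_scale[OF subspace_supported]
  fix x v :: "'f bispace"
  assume v: "v \<in> supported X"
  show "bilin_ext \<beta> x v \<in> supported X"
  proof (induction x rule: bispace_induct)
    case (basis i j)
    from v show ?case
      unfolding span_basis[symmetric]
    proof (induction rule: bispace.span_induct_alt)
      case (step c u w)
      then obtain k l where "u = e k l" "(k, l) \<in> X"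
        by blast
      then have "bilin_ext \<beta> (e i j) u \<in> supported X"
        using closed by (simp add: bilin_ext_e supported_def)
      with step show ?case
        unfolding span_basis by (simp add: bilin_ext_linear add scale)
    qed (simp add: bispace.span_zero)
  qed (simp_all add: bilin_ext_linear add scale)
qed

lemma supported_subset_of_regular:
  assumes "submodule M" "u \<in> M" "q \<in> Poly_Mapping.keys u" "q \<notin> exceptional a b"
  shows "supported (- exceptional a b) \<subseteq> M"
  unfolding supported_subset_iff[OF submodule_subspace[OF assms(1)]]
  using all_regular_basis_mem[OF assms] by blast

text \<open>An intermediate submodule other than \<open>supported X\<close> has a vector with a key
  in \<open>Y - X\<close>. If \<open>Y - X\<close> is one point, removing the part on
  \<open>X\<close> leaves a nonzero multiple of that basis vector; if it consists of all regular
  points, one regular key yields every regular basis vector.\<close>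

lemma irreducible_quotient_supported:
  assumes X: "submodule (supported X)" and Y: "submodule (supported Y)" and "X \<subseteq> Y"
    and diff: "(\<exists>q. Y - X = {q}) \<or> Y - X = - exceptional a b"
  shows "irreducible_quotient (supported Y) (supported X)"
proof (rule irreducible_quotientI[OF X Y])
  \<comment> \<open>A regular point is needed for strict inclusion; columns 0 and 1 cannot both have
    \<open>x = 0\<close>.\<close>
  have "a \<noteq> 0 \<or> a + 1 \<noteq> 0"
    by auto
  then have "(0, l) \<notin> exceptional a b \<or> (1, l) \<notin> exceptional a b" for l
    by (auto simp: exceptional_def)
  then have "X \<noteq> Y"
    using diff by auto
  with \<open>X \<subseteq> Y\<close> show "supported X \<subset> (supported Y :: 'f bispace set)"
    by (simp add: psubset_eq)
  fix P :: "'f bispace set"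
  assume P: "submodule P" "supported X \<subseteq> P" "P \<subseteq> supported Y"
  note sP = submodule_subspace[OF P(1)]
  show "P = supported X \<or> P = supported Y"
  proof (rule disjCI)
    assume "P \<noteq> supported Y"
    show "P = supported X"
    proof (rule ccontr)
      assume "P \<noteq> supported X"
      then obtain u q where u: "u \<in> P" "q \<in> Poly_Mapping.keys u" "q \<notin> X"
        using P(2) by (auto simp: supported_def)
      then have "q \<in> Y - X"
        using P(3) by (auto simp: supported_def)
      from diff have "supported (Y - X) \<subseteq> P"
      proof
        assume "\<exists>q. Y - X = {q}"
        with \<open>q \<in> Y - X\<close> obtain k l where q: "q = (k, l)" "Y - X = {(k, l)}"
          by (metis singletonD surj_pair)
        obtain w where w: "w \<in> supported (Y - X)" "u - w \<in> supported X"
          using supported_split[of u Y X] u(1) P(3) by blast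
        then have "w \<in> P"
          using bispace.subspace_diff[OF sP u(1), of "u - w"] P(2) by auto
        have "q \<notin> Poly_Mapping.keys (u - w)"
          using w(2) u(3) by (auto simp: supported_def)
        then have "q \<in> Poly_Mapping.keys w"
          using u(2) by (auto simp: in_keys_iff lookup_minus)
        then have "Poly_Mapping.keys w = {(k, l)}"
          using w(1) q by (auto simp: supported_def)
        with mem_of_keys_singleton[OF sP \<open>w \<in> P\<close>] show ?thesis
          unfolding q(2) supported_subset_iff[OF sP] by auto
      next
        assume "Y - X = - exceptional a b"
        with supported_subset_of_regular[OF P(1) u(1,2)] \<open>q \<in> Y - X\<close> show ?thesis
          by auto
      qed
      have "supported Y \<subseteq> P"
      proof
        fix v :: "'f bispace"
        assume "v \<in> supported Y"
        then obtain w where "w \<in> supported (Y - X)" "v - w \<in> supported X"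
          using supported_split by blast
        then show "v \<in> P"
          using \<open>supported (Y - X) \<subseteq> P\<close> P(2) bispace.subspace_add[OF sP, of w "v - w"] by auto
      qed
      with P(3) \<open>P \<noteq> supported Y\<close> show False
        by blast
    qed
  qed
qed

lemma corresponds_supported:
  "X \<subseteq> Y \<Longrightarrow> corresponds (supported (Y - X)) (supported Y) (supported X)"
  by (rule correspondsI[OF subspace_supported subspace_supported])
     (auto simp: supported_split, auto simp: supported_def simp flip: keys_eq_empty)

text \<open>The series is \<open>0\<close>, \<open>supported X\<close>, \<open>supported Y\<close>,
  the whole module, with factors represented by the coordinate complements. Only the arrows depend
  on the module.\<close>

lemma composition_structureI:
  assumes XY: "X \<subseteq> Y" and sub: "submodule (supported X)" "submodule (supported Y)"
    and irr: "irreducible_quotient (supported X) (supported {})"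
      "irreducible_quotient (supported Y) (supported X)"
      "irreducible_quotient (supported UNIV) (supported Y)"
    and Ws: "Ws = {supported X, supported (Y - X), supported (- Y)}"
    and gen: "\<And>W W'. W \<in> Ws \<Longrightarrow> W' \<in> Ws \<Longrightarrow> W \<noteq> W' \<Longrightarrow> generates W W' \<longleftrightarrow> (W, W') \<in> D\<^sup>+"
  shows "composition_structure Ws D"
  unfolding composition_structure_def
proof (intro conjI exI ballI impI allI)
  let ?Ms = "[supported {}, supported X, supported Y, supported UNIV] :: 'f bispace set list"
  let ?ws = "[supported X, supported (Y - X), supported (- Y)] :: 'f bispace set list"
  have three: "t = 0 \<or> t = 1 \<or> t = 2" if "t < 3" for t :: nat
    using that by linarith
  have "submodule (supported {})" "submodule (supported UNIV)"
    by (auto intro: submodule_supported)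
  with sub have "\<forall>M\<in>set ?Ms. submodule M"
    by simp
  moreover have "?Ms ! t \<subseteq> ?Ms ! Suc t \<and> irreducible_quotient (?Ms ! Suc t) (?Ms ! t)"
    if "Suc t < length ?Ms" for t
  proof -
    from that have "t < 3"
      by simp
    from three[OF this] irr XY show ?thesis
      by (elim disjE) simp_all
  qed
  ultimately show "composition_series ?Ms"
    unfolding composition_series_def by (simp only: list.sel last.simps list.simps if_False if_True
        supported_empty supported_UNIV simp_thms) blast
  \<comment> \<open>Irreducible quotients are nonzero, so the three index sets are nonempty; being
    pairwise disjoint, they give distinct vertices.\<close>
  have ne: "Z \<noteq> Z'" if "irreducible_quotient (supported Z) (supported Z')" for Z Z'
    using that coset_eq_self_iff[OF subspace_supported, of Z'] subspace_supported[THEN bispace.subspace_0, of Z']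
    unfolding irreducible_quotient_def quotient_def by auto
  show "distinct ?ws"
    using irr[THEN ne] XY by auto
  show "set ?ws = Ws" "length ?Ms = Suc (length ?ws)"
    by (simp_all add: Ws)
  fix t
  assume "t < length ?ws"
  then have "t < 3"
    by simp
  from three[OF this] show "corresponds (?ws ! t) (?Ms ! Suc t) (?Ms ! t)"
    using corresponds_supported[of "{}" X] corresponds_supported[OF XY]
      corresponds_supported[of Y UNIV]
    by (elim disjE) (simp_all add: Compl_eq_Diff_UNIV)
qed (use gen in auto)

section \<open>Arrows between coordinate subspaces\<close>

lemma generates_supported:
  assumes "\<And>M k l. submodule M \<Longrightarrow> supported X \<subseteq> M \<Longrightarrow> (k, l) \<in> Y \<Longrightarrow> e k l \<in> M"
  shows "generates (supported X) (supported Y)"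
  unfolding generates_iff using assms supported_subset_iff[OF submodule_subspace] by blast

lemma generates_trans: "generates S T \<Longrightarrow> generates T U \<Longrightarrow> generates S U"
  unfolding generates_iff by blast

lemma not_generates:
  "submodule (supported Z) \<Longrightarrow> X \<subseteq> Z \<Longrightarrow> \<not> Y \<subseteq> Z \<Longrightarrow> \<not> generates (supported X) (supported Y)"
  unfolding generates_iff by (metis supported_mono_iff)

lemma act_basis_mem:
  assumes "submodule M" "supported X \<subseteq> M" "(k, l) \<in> X"
  shows "\<beta> i j k l \<in> M"
proof -
  have "e k l \<in> M"
    using assms supported_subset_iff[OF submodule_subspace] by blast
  from submodule_act[OF assms(1) this, of "e i j"] show ?thesis
    by (simp add: bilin_ext_e)
qed

lemma generates_basis:
  assumes "(k, l) \<in> X" "\<beta> i j k l = scale c (e k' l')" "c \<noteq> 0"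
  shows "generates (supported X) (supported {(k', l')})"
proof (rule generates_supported)
  fix M k'' l''
  assume "submodule M" "supported X \<subseteq> M" "(k'', l'') \<in> {(k', l')}"
  then show "e k'' l'' \<in> M"
    using act_basis_mem[of M X k l i j] assms by (simp add: scale_mem_iff submodule_subspace)
qed

text \<open>One step onto a regular index suffices, since any regular basis vector generates all the
  others.\<close>

lemma generates_regular:
  assumes "(k, l) \<in> X" "\<beta> i j k l = scale c (e k' l')" "c \<noteq> 0" "(k', l') \<notin> exceptional a b"
  shows "generates (supported X) (supported (- exceptional a b))"
proof (rule generates_supported)
  fix M k'' l''
  assume M: "submodule M" "supported X \<subseteq> M" and "(k'', l'') \<in> - exceptional a b"
  have "e k' l' \<in> M"
    using act_basis_mem[OF M assms(1), of i j] M assms by (simp add: scale_mem_iff submodule_subspace)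
  then show "e k'' l'' \<in> M"
    by (rule all_regular_basis_mem[OF M(1), of _ "(k', l')"])
      (use assms \<open>(k'', l'') \<in> _\<close> in auto)
qed

text \<open>Every nonzero vector then has a regular key.\<close>

lemma irreducible_if_no_exceptional:
  assumes "exceptional a b = {}"
  shows irreducible_module
proof -
  have "(e 0 0 :: 'f bispace) \<noteq> 0"
    by (metis insert_not_empty keys_e keys_zero)
  moreover have "M = UNIV" if M: "submodule M" "M \<noteq> {0}" for M
  proof -
    have "0 \<in> M"
      by (rule bispace.subspace_0[OF submodule_subspace[OF M(1)]])
    then obtain u where "u \<in> M" "u \<noteq> 0"
      using M(2) by blast
    moreover from this obtain q where "q \<in> Poly_Mapping.keys u"
      using keys_eq_empty by fastforce
    ultimately show ?thesis
      using supported_subset_of_regular[OF M(1)] assms supported_UNIV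
      by (metis Compl_empty_eq empty_iff top.extremum_uniqueI)
  qed
  ultimately show ?thesis
    unfolding irreducible_module_def by auto
qed

section \<open>The three diagram shapes for two exceptional points\<close>

context
  fixes s1 s2
  assumes exceptional_eq: "exceptional a b = {s1, s2}" and points_ne: "s1 \<noteq> s2"
begin

lemma third_point: "\<not> - {s1, s2} \<subseteq> {s1}" "\<not> - {s1, s2} \<subseteq> {s2}"
proof -
  \<comment> \<open>This point differs from \<open>s1\<close> in the first coordinate and from
    \<open>s2\<close> in the second.\<close>
  have "(fst s1 + 1, snd s2 + 1) \<in> - {s1, s2}"
    by (auto simp: prod_eq_iff)
  then show "\<not> - {s1, s2} \<subseteq> {s1}" "\<not> - {s1, s2} \<subseteq> {s2}"
    by blast+
qed

lemma diagram_vertices_ne: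
  "supported {s1} \<noteq> (supported {s2} :: 'f bispace set)"
  "supported {s1} \<noteq> (supported (- {s1, s2}) :: 'f bispace set)"
  "supported {s2} \<noteq> (supported (- {s1, s2}) :: 'f bispace set)"
  using points_ne by auto

text \<open>The series adds \<open>s1\<close>, then the regular points, then \<open>s2\<close>. Its
  members \<open>supported {s1}\<close> and \<open>supported (- {s2})\<close> also rule out the
  backward arrows.\<close>

lemma composition_structure_chain:
  assumes s1: "submodule (supported {s1})" and s2: "submodule (supported (- {s2}))"
    and gen: "generates (supported {s2}) (supported (- {s1, s2}))"
      "generates (supported (- {s1, s2})) (supported {s1})"
  shows "composition_structure {supported {s1}, supported {s2}, supported (- {s1, s2})}
    {(supported {s2}, supported (- {s1, s2})), (supported (- {s1, s2}), supported {s1})}"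
proof (rule composition_structureI[OF _ s1 s2])
  let ?V1 = "supported {s1} :: 'f bispace set" and ?V2 = "supported {s2} :: 'f bispace set"
    and ?V3 = "supported (- {s1, s2}) :: 'f bispace set"
  have diff: "- {s2} - {s1} = - exceptional a b"
    by (auto simp: exceptional_eq)
  have zero: "submodule (supported {})" and one: "submodule (supported UNIV)"
    by (auto intro: submodule_supported)
  show "{s1} \<subseteq> - {s2}"
    using points_ne by auto
  show "irreducible_quotient ?V1 (supported {})"
    by (rule irreducible_quotient_supported[OF zero s1]) auto
  show "irreducible_quotient (supported (- {s2})) ?V1"
    by (rule irreducible_quotient_supported[OF s1 s2]) (use points_ne diff in auto)
  show "irreducible_quotient (supported UNIV) (supported (- {s2}))"
    by (rule irreducible_quotient_supported[OF s2 one]) auto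
  show "{?V1, ?V2, ?V3} = {?V1, supported (- {s2} - {s1}), supported (- (- {s2}))}"
    unfolding diff exceptional_eq double_complement by auto
  have "\<not> generates ?V1 ?V2" "\<not> generates ?V1 ?V3" "\<not> generates ?V3 ?V2"
    using points_ne not_generates[OF s1 order_refl third_point(1)]
      not_generates[OF s1, of "{s1}" "{s2}"] not_generates[OF s2, of "- {s1, s2}" "{s2}"] by auto
  moreover have "generates ?V2 ?V1"
    using generates_trans[OF gen] .
  moreover have "{(?V2, ?V3), (?V3, ?V1)}\<^sup>+ = {(?V2, ?V3), (?V3, ?V1), (?V2, ?V1)}"
    by (rule trancl_two_steps) (use diagram_vertices_ne in auto)
  ultimately show "generates W W' \<longleftrightarrow> (W, W') \<in> {(?V2, ?V3), (?V3, ?V1)}\<^sup>+"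
    if "W \<in> {?V1, ?V2, ?V3}" "W' \<in> {?V1, ?V2, ?V3}" "W \<noteq> W'" for W W'
    using that gen diagram_vertices_ne by (elim insertE emptyE) (simp_all del: supported_eq_iff)
qed

text \<open>Each exceptional line is a submodule, so no arrow leaves it; the regular points come
  last in the series.\<close>

lemma composition_structure_source:
  assumes s1: "submodule (supported {s1})" and s2: "submodule (supported {s2})"
    and gen: "generates (supported (- {s1, s2})) (supported {s1})"
      "generates (supported (- {s1, s2})) (supported {s2})"
    and s12: "submodule (supported {s1, s2})"
  shows "composition_structure {supported {s1}, supported {s2}, supported (- {s1, s2})}
    {(supported (- {s1, s2}), supported {s1}), (supported (- {s1, s2}), supported {s2})}"
proof (rule composition_structureI[OF _ s1 s12])
  let ?V1 = "supported {s1} :: 'f bispace set" and ?V2 = "supported {s2} :: 'f bispace set"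
    and ?V3 = "supported (- {s1, s2}) :: 'f bispace set"
  have diff: "{s1, s2} - {s1} = {s2}"
    using points_ne by auto
  have zero: "submodule (supported {})" and one: "submodule (supported UNIV)"
    by (auto intro: submodule_supported)
  show "{s1} \<subseteq> {s1, s2}"
    by simp
  show "irreducible_quotient ?V1 (supported {})"
    by (rule irreducible_quotient_supported[OF zero s1]) auto
  show "irreducible_quotient (supported {s1, s2}) ?V1"
    by (rule irreducible_quotient_supported[OF s1 s12]) (use diff in auto)
  show "irreducible_quotient (supported UNIV) (supported {s1, s2})"
    by (rule irreducible_quotient_supported[OF s12 one]) (use exceptional_eq in auto)
  show "{?V1, ?V2, ?V3} = {?V1, supported ({s1, s2} - {s1}), ?V3}"
    by (simp only: diff)
  have "\<not> generates ?V1 ?V2" "\<not> generates ?V1 ?V3" "\<not> generates ?V2 ?V1" "\<not> generates ?V2 ?V3"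
    using points_ne not_generates[OF s1 order_refl third_point(1)] not_generates[OF s2 order_refl third_point(2)]
      not_generates[OF s1, of "{s1}" "{s2}"] not_generates[OF s2, of "{s2}" "{s1}"] by auto
  moreover have "{(?V3, ?V1), (?V3, ?V2)}\<^sup>+ = {(?V3, ?V1), (?V3, ?V2)}"
    by (rule trancl_id, rule transI) (use diagram_vertices_ne in \<open>auto simp del: supported_eq_iff\<close>)
  ultimately show "generates W W' \<longleftrightarrow> (W, W') \<in> {(?V3, ?V1), (?V3, ?V2)}\<^sup>+"
    if "W \<in> {?V1, ?V2, ?V3}" "W' \<in> {?V1, ?V2, ?V3}" "W \<noteq> W'" for W W'
    using that gen diagram_vertices_ne by (elim insertE emptyE) (simp_all del: supported_eq_iff)
qed

text \<open>Omitting either exceptional index leaves a submodule, so no arrow enters that index; the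
  regular points come first in the series.\<close>

lemma composition_structure_sink:
  assumes s12: "submodule (supported (- {s1, s2}))"
    and s1: "submodule (supported (- {s1}))" and s2: "submodule (supported (- {s2}))"
    and gen: "generates (supported {s1}) (supported (- {s1, s2}))"
      "generates (supported {s2}) (supported (- {s1, s2}))"
  shows "composition_structure {supported {s1}, supported {s2}, supported (- {s1, s2})}
    {(supported {s1}, supported (- {s1, s2})), (supported {s2}, supported (- {s1, s2}))}"
proof (rule composition_structureI[OF _ s12 s2])
  let ?V1 = "supported {s1} :: 'f bispace set" and ?V2 = "supported {s2} :: 'f bispace set"
    and ?V3 = "supported (- {s1, s2}) :: 'f bispace set"
  have diff: "- {s2} - - {s1, s2} = {s1}"
    using points_ne by auto
  have zero: "submodule (supported {})" and one: "submodule (supported UNIV)"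
    by (auto intro: submodule_supported)
  show "- {s1, s2} \<subseteq> - {s2}"
    by auto
  show "irreducible_quotient ?V3 (supported {})"
    by (rule irreducible_quotient_supported[OF zero s12]) (auto simp: exceptional_eq)
  show "irreducible_quotient (supported (- {s2})) ?V3"
    by (rule irreducible_quotient_supported[OF s12 s2]) (use diff in auto)
  show "irreducible_quotient (supported UNIV) (supported (- {s2}))"
    by (rule irreducible_quotient_supported[OF s2 one]) auto
  show "{?V1, ?V2, ?V3} = {?V3, supported (- {s2} - - {s1, s2}), supported (- (- {s2}))}"
    unfolding diff double_complement by auto
  have "\<not> generates ?V1 ?V2" "\<not> generates ?V2 ?V1" "\<not> generates ?V3 ?V1" "\<not> generates ?V3 ?V2"
    using points_ne not_generates[OF s2, of "{s1}"] not_generates[OF s1, of "{s2}"]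
      not_generates[OF s1, of "- {s1, s2}"] not_generates[OF s2, of "- {s1, s2}"] by auto
  moreover have "{(?V1, ?V3), (?V2, ?V3)}\<^sup>+ = {(?V1, ?V3), (?V2, ?V3)}"
    by (rule trancl_id, rule transI) (use diagram_vertices_ne in \<open>auto simp del: supported_eq_iff\<close>)
  ultimately show "generates W W' \<longleftrightarrow> (W, W') \<in> {(?V1, ?V3), (?V2, ?V3)}\<^sup>+"
    if "W \<in> {?V1, ?V2, ?V3}" "W' \<in> {?V1, ?V2, ?V3}" "W \<noteq> W'" for W W'
    using that gen diagram_vertices_ne by (elim insertE emptyE) (simp_all del: supported_eq_iff)
qed

end

end

section \<open>Structure of the four modules\<close>

lemma modified_Aab_Aab: "modified_Aab (Aab_basis a b) a b"
proof (intro modified_Aab.intro modified_Aab_axioms.intro)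
  show "lie_module scale L_bracket scale (bilin_ext (Aab_basis a b))"
    using lie_module_Aab[of a b] by (simp add: Aab_act_def)
qed (simp_all add: Aab_basis_def keys_scale)

lemma exceptional_zero: "exceptional (0 :: 'f::field_char_0) 0 = {(0, -1), (0, -2)}"
proof -
  have "of_int l = (- 1 :: 'f) \<longleftrightarrow> l = - 1" "of_int l = (- 2 :: 'f) \<longleftrightarrow> l = - 2" for l
    using of_int_eq_iff[of l "- 1", where ?'a = 'f] of_int_eq_iff[of l "- 2", where ?'a = 'f] by auto
  then show ?thesis
    by (auto simp: exceptional_def)
qed

lemma modified_Aab_A: "modified_Aab (A_basis :: _ \<Rightarrow> _ \<Rightarrow> _ \<Rightarrow> _ \<Rightarrow> 'f::field_char_0 bispace) 0 0"
proof (intro modified_Aab.intro modified_Aab_axioms.intro)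
  show "lie_module scale L_bracket scale (bilin_ext (A_basis :: _ \<Rightarrow> _ \<Rightarrow> _ \<Rightarrow> _ \<Rightarrow> 'f bispace))"
    using lie_module_A by (simp add: A_act_def)
  fix i j k l
  show "A_basis i j k l = (Aab_basis 0 0 i j k l :: 'f bispace)"
    if "(k, l) \<notin> exceptional (0 :: 'f) 0" "(i + k, j + l) \<notin> exceptional (0 :: 'f) 0"
    using that by (auto simp: exceptional_zero A_basis_def Aab_basis_def algebra_simps)
  show "A_basis 0 0 k l = (scale (0 + of_int k) (e k l) :: 'f bispace)"
    by (simp add: A_basis_def)
  show "Poly_Mapping.keys (A_basis i j k l :: 'f bispace) \<subseteq> insert (i + k, j + l) (exceptional (0 :: 'f) 0)"
    by (simp add: exceptional_zero A_basis_def keys_scale order_trans[OF keys_add])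
qed

lemma modified_Aab_B: "modified_Aab (B_basis :: _ \<Rightarrow> _ \<Rightarrow> _ \<Rightarrow> _ \<Rightarrow> 'f::field_char_0 bispace) 0 0"
proof (intro modified_Aab.intro modified_Aab_axioms.intro)
  show "lie_module scale L_bracket scale (bilin_ext (B_basis :: _ \<Rightarrow> _ \<Rightarrow> _ \<Rightarrow> _ \<Rightarrow> 'f bispace))"
    using lie_module_B by (simp add: B_act_def)
  fix i j k l
  show "B_basis i j k l = (Aab_basis 0 0 i j k l :: 'f bispace)"
    if "(k, l) \<notin> exceptional (0 :: 'f) 0" "(i + k, j + l) \<notin> exceptional (0 :: 'f) 0"
  proof -
    have "B_coeff i j k l = (j + 1) * k - (l + 1) * i"
      using that by (auto simp: exceptional_zero B_coeff_def)
    then show ?thesis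
      by (simp only: B_coeff) (simp add: Aab_basis_def algebra_simps)
  qed
  show "B_basis 0 0 k l = (scale (0 + of_int k) (e k l) :: 'f bispace)"
    by (simp add: B_coeff B_coeff_def)
  show "Poly_Mapping.keys (B_basis i j k l :: 'f bispace) \<subseteq> insert (i + k, j + l) (exceptional (0 :: 'f) 0)"
    by (simp add: B_coeff keys_scale)
qed

lemma modified_Aab_C: "modified_Aab (C_basis :: _ \<Rightarrow> _ \<Rightarrow> _ \<Rightarrow> _ \<Rightarrow> 'f::field_char_0 bispace) 0 0"
proof (intro modified_Aab.intro modified_Aab_axioms.intro)
  show "lie_module scale L_bracket scale (bilin_ext (C_basis :: _ \<Rightarrow> _ \<Rightarrow> _ \<Rightarrow> _ \<Rightarrow> 'f bispace))"
    using lie_module_C by (simp add: C_act_def)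
  fix i j k l
  show "C_basis i j k l = (Aab_basis 0 0 i j k l :: 'f bispace)"
    if "(k, l) \<notin> exceptional (0 :: 'f) 0" "(i + k, j + l) \<notin> exceptional (0 :: 'f) 0"
  proof -
    have "B_coeff i j k l = (j + 1) * k - (l + 1) * i"
      "\<not> (k = 0 \<and> l = - 2)" "\<not> (i + k = 0 \<and> j + l = - 2)"
      using that by (auto simp: exceptional_zero B_coeff_def)
    then show ?thesis
      unfolding C_coeff by (simp only: if_False) (simp add: Aab_basis_def algebra_simps)
  qed
  show "C_basis 0 0 k l = (scale (0 + of_int k) (e k l) :: 'f bispace)"
    by (auto simp add: C_coeff B_coeff_def)
  show "Poly_Mapping.keys (C_basis i j k l :: 'f bispace) \<subseteq> insert (i + k, j + l) (exceptional (0 :: 'f) 0)"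
    unfolding C_coeff by (rule order_trans[OF keys_add]) (simp add: exceptional_zero keys_scale)
qed

section \<open>The diagrams of the four modules\<close>

lemma composition_structure_Aab:
  fixes m n :: int
  defines "s1 \<equiv> (- m, n - 1)" and "s2 \<equiv> (- m, n - 2)"
  shows "lie_module.composition_structure scale (Aab_act (of_int m) (of_int n :: 'f::field_char_0))
    {supported {s1}, supported {s2}, supported (- {s1, s2})}
    {(supported {s2}, supported (- {s1, s2})), (supported (- {s1, s2}), supported {s1})}"
proof -
  interpret modified_Aab "Aab_basis (of_int m) (of_int n :: 'f)" "of_int m" "of_int n"
    by (rule modified_Aab_Aab)
  have coeff: "Aab_basis (of_int m) (of_int n :: 'f) i j k l =
      scale (of_int ((j + 1) * (m + k) + (n - 1 - l) * i)) (e (i + k) (j + l))" for i j k l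
    by (simp add: Aab_basis_def)
  have "(of_int m + of_int k = (0 :: 'f) \<and> (of_int l = (of_int n - 1 :: 'f) \<or> of_int l = (of_int n - 2 :: 'f)))
      \<longleftrightarrow> (k, l) \<in> {s1, s2}" for k l
  proof -
    have "of_int m + of_int k = (0 :: 'f) \<longleftrightarrow> m + k = 0"
      using of_int_eq_iff[of "m + k" 0, where ?'a = 'f] by simp
    moreover have "of_int l = (of_int n - 1 :: 'f) \<longleftrightarrow> l = n - 1"
      using of_int_eq_iff[of l "n - 1", where ?'a = 'f] by simp
    moreover have "of_int l = (of_int n - 2 :: 'f) \<longleftrightarrow> l = n - 2"
      using of_int_eq_iff[of l "n - 2", where ?'a = 'f] by simp
    ultimately show ?thesis
      by (auto simp: s1_def s2_def)
  qed
  then have exc: "exceptional (of_int m) (of_int n :: 'f) = {s1, s2}"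
    unfolding exceptional_def by auto
  have ne: "s1 \<noteq> s2"
    by (simp add: s1_def s2_def)
  show ?thesis
    unfolding Aab_act_def
  proof (rule composition_structure_chain[OF exc ne])
    \<comment> \<open>At \<open>s1\<close>, where \<open>(x, y) = (0, 0)\<close>, all structure
      constants vanish.\<close>
    show "submodule (supported {s1})"
      by (rule submodule_supported) (auto simp: s1_def coeff keys_scale)
    show "submodule (supported (- {s2}))"
    proof (rule submodule_supported)
      fix i j k l
      \<comment> \<open>The coefficient is \<open>x (y' + 1) - x' y\<close>, which is zero for the
        target \<open>(x', y') = (0, -1)\<close>, that is \<open>s2\<close>.\<close>
      have zero: "(j + 1) * (m + k) + (n - 1 - l) * i = 0" if "(i + k, j + l) = s2"
      proof -
        from that have kl: "k = - m - i" "l = n - 2 - j"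
          by (auto simp: s2_def)
        show ?thesis
          unfolding kl by (simp add: algebra_simps)
      qed
      show "Poly_Mapping.keys (Aab_basis (of_int m) (of_int n :: 'f) i j k l) \<subseteq> - {s2}"
      proof (cases "(i + k, j + l) = s2")
        case True
        then show ?thesis
          by (simp only: coeff zero of_int_0 bispace.scale_zero_left keys_zero empty_subsetI)
      next
        case False
        then show ?thesis
          by (auto simp: coeff keys_scale)
      qed
    qed
    \<comment> \<open>\<open>e 1 0\<close> moves \<open>s2\<close> to the neighbouring column with
      coefficient 1.\<close>
    show "generates (supported {s2}) (supported (- {s1, s2}))"
      using generates_regular[of "- m" "n - 2" "{s2}" 1 0 1 "1 - m" "n - 2"]
      unfolding exc by (simp add: coeff s1_def s2_def)
    show "generates (supported (- {s1, s2})) (supported {s1})"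
      using generates_basis[of "1 - m" "n - 1" "- {s1, s2}" "- 1" 0 1 "- m" "n - 1"]
      by (simp add: coeff s1_def s2_def)
  qed
qed

lemma composition_structure_A:
  defines "s1 \<equiv> (0, - 1)" and "s2 \<equiv> (0, - 2)"
  shows "lie_module.composition_structure scale (A_act :: 'f::field_char_0 bispace \<Rightarrow> _)
    {supported {s1}, supported {s2}, supported (- {s1, s2})}
    {(supported (- {s1, s2}), supported {s1}), (supported (- {s1, s2}), supported {s2})}"
proof -
  interpret modified_Aab A_basis 0 "0 :: 'f"
    by (rule modified_Aab_A)
  have exc: "exceptional 0 (0 :: 'f) = {s1, s2}" and ne: "s1 \<noteq> s2"
    by (simp_all add: exceptional_zero s1_def s2_def)
  \<comment> \<open>At \<open>(0, -1)\<close> the delta term requires \<open>i = 0\<close>, and its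
    factor \<open>i\<close> then makes it vanish.\<close>
  have act: "A_basis i j 0 (- 1) = (0 :: 'f bispace)" "A_basis i j 0 (- 2) = (0 :: 'f bispace)" for i j
    by (auto simp: A_basis_def)
  show ?thesis
    unfolding A_act_def
  proof (rule composition_structure_source[OF exc ne])
    show "submodule (supported {s1})" "submodule (supported {s2})" "submodule (supported {s1, s2})"
      by (rule submodule_supported, auto simp: s1_def s2_def act)+
    show "generates (supported (- {s1, s2})) (supported {s1})"
      using generates_basis[of 1 "- 1" "- {s1, s2}" "- 1" 0 1 0 "- 1"]
      by (simp add: A_basis_def s1_def s2_def)
    \<comment> \<open>The ordinary coefficient into \<open>(0, -2)\<close> always vanishes; this
      arrow comes from the delta term, here with value -1.\<close>
    show "generates (supported (- {s1, s2})) (supported {s2})"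
      using generates_basis[of 1 "- 1" "- {s1, s2}" "- 1" "- 1" "- 1" 0 "- 2"]
      by (simp add: A_basis_def s1_def s2_def)
  qed
qed

text \<open>Into \<open>(0, -1)\<close> the coefficient is suppressed by definition, or equals
  \<open>i = 0\<close> when the source is also \<open>(0, -1)\<close>; into \<open>(0, -2)\<close>
  the two terms cancel.\<close>

lemma B_coeff_eq_0:
  assumes "i + k = 0" "j + l = - 1 \<or> j + l = - 2"
  shows "B_coeff i j k l = 0"
  using assms B_coeff_zero[of i k j l] by (auto simp: B_coeff_def)

lemma composition_structure_B:
  defines "s1 \<equiv> (0, - 1)" and "s2 \<equiv> (0, - 2)"
  shows "lie_module.composition_structure scale (B_act :: 'f::field_char_0 bispace \<Rightarrow> _)
    {supported {s1}, supported {s2}, supported (- {s1, s2})}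
    {(supported {s1}, supported (- {s1, s2})), (supported {s2}, supported (- {s1, s2}))}"
proof -
  interpret modified_Aab B_basis 0 "0 :: 'f"
    by (rule modified_Aab_B)
  have exc: "exceptional 0 (0 :: 'f) = {s1, s2}" and ne: "s1 \<noteq> s2"
    by (simp_all add: exceptional_zero s1_def s2_def)
  \<comment> \<open>All images lie in the regular part, so every index set containing the regular
    points spans a submodule.\<close>
  have keys: "Poly_Mapping.keys (B_basis i j k l :: 'f bispace) \<subseteq> - {s1, s2}" for i j k l
    using B_coeff_eq_0[of i k j l] by (auto simp: B_coeff keys_scale s1_def s2_def)
  show ?thesis
    unfolding B_act_def
  proof (rule composition_structure_sink[OF exc ne])
    show "submodule (supported (- {s1, s2}))" "submodule (supported (- {s1}))"
      "submodule (supported (- {s2}))"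
      by (rule submodule_supported, use keys in blast)+
    show "generates (supported {s1}) (supported (- {s1, s2}))"
      using generates_regular[of 0 "- 1" "{s1}" 1 0 1 1 "- 1"]
      unfolding exc by (simp add: B_basis_def s1_def s2_def)
    show "generates (supported {s2}) (supported (- {s1, s2}))"
      using generates_regular[of 0 "- 2" "{s2}" 1 0 1 1 "- 2"]
      unfolding exc by (simp add: B_basis_def s1_def s2_def)
  qed
qed

lemma composition_structure_C:
  defines "s1 \<equiv> (0, - 1)" and "s2 \<equiv> (0, - 2)"
  shows "lie_module.composition_structure scale (C_act :: 'f::field_char_0 bispace \<Rightarrow> _)
    {supported {s1}, supported {s2}, supported (- {s1, s2})}
    {(supported {s1}, supported (- {s1, s2})), (supported (- {s1, s2}), supported {s2})}"
proof -
  interpret modified_Aab C_basis 0 "0 :: 'f"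
    by (rule modified_Aab_C)
  \<comment> \<open>The points are listed in reverse, because \<open>(0, -2)\<close> is now at the
    bottom of the chain and \<open>(0, -1)\<close> at the top.\<close>
  have exc: "exceptional 0 (0 :: 'f) = {s2, s1}" and ne: "s2 \<noteq> s1"
    by (auto simp: exceptional_zero s1_def s2_def)
  have "composition_structure {supported {s2}, supported {s1}, supported (- {s2, s1})}
    {(supported {s1}, supported (- {s2, s1})), (supported (- {s2, s1}), supported {s2})}"
  proof (rule composition_structure_chain[OF exc ne])
    show "submodule (supported {s2})"
      by (rule submodule_supported) (simp add: s2_def C_basis_def)
    show "submodule (supported (- {s1}))"
    proof (rule submodule_supported)
      fix i j k l
      have "s1 \<notin> Poly_Mapping.keys
          (scale (of_int (if k = 0 \<and> l = - 2 then 0 else B_coeff i j k l)) (e (i + k) (j + l)) :: 'f bispace)"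
        using B_coeff_eq_0[of i k j l] by (auto simp: keys_scale s1_def)
      moreover have "s1 \<notin> Poly_Mapping.keys
          (scale (of_int (if i + k = 0 \<and> j + l = - 2 then i else 0)) (e 0 (- 2)) :: 'f bispace)"
        by (auto simp: keys_scale s1_def)
      ultimately show "Poly_Mapping.keys (C_basis i j k l :: 'f bispace) \<subseteq> - {s1}"
        unfolding C_coeff by (auto dest!: subsetD[OF keys_add])
    qed
    show "generates (supported {s1}) (supported (- {s2, s1}))"
      using generates_regular[of 0 "- 1" "{s1}" 1 0 1 1 "- 1"]
      unfolding exc by (simp add: C_basis_def s1_def s2_def)
    \<comment> \<open>As for \<open>A\<close>, the delta term alone reaches
      \<open>(0, -2)\<close>.\<close>
    show "generates (supported (- {s2, s1})) (supported {s2})"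
      using generates_basis[of 1 "- 1" "- {s2, s1}" "- 1" "- 1" "- 1" 0 "- 2"]
      by (simp add: C_basis_def s1_def s2_def)
  qed
  then show ?thesis
    unfolding C_act_def insert_commute[of s2 s1] insert_commute[of "supported {s2}" "supported {s1}"] .
qed

text \<open>Exceptional points force both parameters to be integral; conversely, for integral
  parameters the line at \<open>(- m, n - 1)\<close> is annihilated and is a proper nonzero
  submodule.\<close>

lemma irreducible_Aab_iff:
  "lie_module.irreducible_module scale (Aab_act a b) \<longleftrightarrow> a \<notin> \<int> \<or> (a \<in> \<int> \<and> b \<notin> \<int>)"
  for a b :: "'f::field_char_0"
proof -
  interpret modified_Aab "Aab_basis a b" a b
    by (rule modified_Aab_Aab)
  show ?thesis
    unfolding Aab_act_def
  proof
    show irreducible_module if "a \<notin> \<int> \<or> (a \<in> \<int> \<and> b \<notin> \<int>)"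
    proof (rule irreducible_if_no_exceptional)
      have "a \<in> \<int> \<and> b \<in> \<int>" if "(k, l) \<in> exceptional a b" for k l
      proof -
        from that have "a = of_int (- k)" "b = of_int (l + 1) \<or> b = of_int (l + 2)"
          by (auto simp: exceptional_def add_eq_0_iff2)
        then show ?thesis
          by (metis Ints_of_int)
      qed
      with that show "exceptional a b = {}"
        by auto
    qed
    assume irr: irreducible_module
    show "a \<notin> \<int> \<or> (a \<in> \<int> \<and> b \<notin> \<int>)"
    proof (rule ccontr)
      assume "\<not> ?thesis"
      then obtain m n where ab: "a = of_int m" "b = of_int n"
        by (auto elim!: Ints_cases)
      have "submodule (supported {(- m, n - 1)})"
        by (rule submodule_supported) (auto simp: Aab_basis_def ab)
      moreover have "(- m, n) \<notin> {(- m, n - 1)}"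
        by simp
      then have "supported {(- m, n - 1)} \<noteq> (supported {} :: 'f bispace set)"
        "supported {(- m, n - 1)} \<noteq> (supported UNIV :: 'f bispace set)"
        unfolding supported_eq_iff by blast+
      ultimately show False
        using irr unfolding irreducible_module_def supported_empty supported_UNIV by blast
    qed
  qed
qed

theorem theorem1p2:
  shows
    "(\<forall>a b :: 'f::field_char_0.
        lie_module.irreducible_module scale (Aab_act a b) \<longleftrightarrow> a \<notin> \<int> \<or> (a \<in> \<int> \<and> b \<notin> \<int>)) \<and>
     (\<forall>(a :: 'f) (b :: 'f) (m :: int) (n :: int). a = of_int m \<and> b = of_int n \<longrightarrow>
        (let V1 = bispace.span {e (- m) (n - 1)};
             V2 = bispace.span {e (- m) (n - 2)};
             V3 = bispace.span {e k l | k l. (k, l) \<noteq> (- m, n - 1) \<and> (k, l) \<noteq> (- m, n - 2)}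
         in lie_module.composition_structure scale (Aab_act a b)
              {V1, V2, V3} {(V2, V3), (V3, V1)})) \<and>
     (let V1 = bispace.span {e 0 (-1) :: 'f bispace};
          V2 = bispace.span {e 0 (-2)};
          V3 = bispace.span {e k l | k l. (k, l) \<noteq> (0, -1) \<and> (k, l) \<noteq> (0, -2)}
      in lie_module.composition_structure scale A_act {V1, V2, V3} {(V3, V1), (V3, V2)} \<and>
         lie_module.composition_structure scale B_act {V1, V2, V3} {(V1, V3), (V2, V3)} \<and>
         lie_module.composition_structure scale C_act {V1, V2, V3} {(V1, V3), (V3, V2)})"
proof -
  have "bispace.span {e k l | k l. (k, l) \<noteq> p \<and> (k, l) \<noteq> q} = (supported (- {p, q}) :: 'f bispace set)" for p q
    unfolding span_basis[symmetric] by simp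
  note V = Let_def span_basis_single this
  show ?thesis
    unfolding V
  proof (intro conjI allI impI)
    fix a b :: 'f and m n :: int
    assume "a = of_int m \<and> b = of_int n"
    then show "lie_module.composition_structure scale (Aab_act a b)
        {supported {(- m, n - 1)}, supported {(- m, n - 2)}, supported (- {(- m, n - 1), (- m, n - 2)})}
        {(supported {(- m, n - 2)}, supported (- {(- m, n - 1), (- m, n - 2)})),
         (supported (- {(- m, n - 1), (- m, n - 2)}), supported {(- m, n - 1)})}"
      by (elim conjE) (simp only: composition_structure_Aab)
  qed (rule irreducible_Aab_iff composition_structure_A composition_structure_B composition_structure_C)+
qed

end
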